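(* There are universal constants $C\ge1$ and $C'>0$ such that the following holds. Let $\mathbb{F}\in\{\mathbb{R},\mathbb{C}\}$, let $M_1,\dots,M_d\in\mathbb{F}^{n\times n}$ be linearly independent, $\mathcal{F}=\mathrm{span}\{M_1,\dots,M_d\}$, and let $B\in\mathbb{F}^{n\times n}$ be arbitrary. Consider the following procedure with $p$ queries: draw iid standard normal vectors $x_1,\dots,x_p,y_1,\dots,y_p\in\mathbb{F}^n$; form $F\in\mathbb{F}^{p\times d}$ with $F_{ij}=y_i^{\mathsf T}M_jx_i$ and $g\in\mathbb{F}^p$ with $g_i = y_i^{\mathsf T}Bx_i$; let $\tilde x = F^\dagger g$ and $\tilde B=\sum_{j=1}^d\tilde x_jM_j$. Then with some $p\le C'd$ bilinear queries, with probability at least $9/10$, \[ \|B-\tilde B\|_F\le C\min_{M\in\mathcal{F}}\|B-M\|_F . \]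
   Context: $^{\mathsf T}$ is the plain (non-conjugate) transpose; $^\dagger$ is the Moore–Penrose pseudoinverse. A standard normal vector in $\mathbb{R}^n$ has iid $N(0,1)$ entries; in $\mathbb{C}^n$ it has iid entries $(Z_1+iZ_2)/\sqrt2$ with $Z_1,Z_2$ iid $N(0,1)$. *)

theory Defs
  imports
    "HOL-Probability.Probability"
    "Jordan_Normal_Form.Matrix"
    "Jordan_Normal_Form.Schur_Decomposition"
begin

unbundle no vec_syntax

(* The law of (Z1 + i Z2) / sqrt 2 with Z1, Z2 iid N(0,1).  The real counterpart is the
   library's std_normal_distribution. *)
definition complex_std_normal :: "complex measure" where
  "complex_std_normal =
     distr (std_normal_distribution \<Otimes>\<^sub>M std_normal_distribution) borel
       (\<lambda>(z1, z2). (complex_of_real z1 + \<i> * complex_of_real z2) / complex_of_real (sqrt 2))"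

(* In the following, N is the law of a single standard normal scalar.  A vector is drawn as its
   coordinate function on {..<n}; the functions are turned into vectors by Matrix.vec n. *)
definition std_normal_vector :: "'a measure \<Rightarrow> nat \<Rightarrow> (nat \<Rightarrow> 'a) measure" where
  "std_normal_vector N n = (\<Pi>\<^sub>M i\<in>{..<n}. N)"

(* The joint law of x_1, ..., x_p, y_1, ..., y_p (indexed from 0). *)
definition query_space ::
  "'a measure \<Rightarrow> nat \<Rightarrow> nat \<Rightarrow> ((nat \<Rightarrow> nat \<Rightarrow> 'a) \<times> (nat \<Rightarrow> nat \<Rightarrow> 'a)) measure" where
  "query_space N n p =
     (\<Pi>\<^sub>M i\<in>{..<p}. std_normal_vector N n) \<Otimes>\<^sub>M (\<Pi>\<^sub>M i\<in>{..<p}. std_normal_vector N n)"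

definition frobenius_norm :: "'a::real_normed_field mat \<Rightarrow> real" where
  "frobenius_norm A = sqrt (\<Sum>i<dim_row A. \<Sum>j<dim_col A. (norm (A $$ (i, j)))\<^sup>2)"

definition mat_lincomb :: "nat \<Rightarrow> nat \<Rightarrow> (nat \<Rightarrow> 'a::field) \<Rightarrow> (nat \<Rightarrow> 'a mat) \<Rightarrow> 'a mat" where
  "mat_lincomb n d c M = mat n n (\<lambda>ab. \<Sum>j<d. c j * M j $$ ab)"

definition mat_span :: "nat \<Rightarrow> nat \<Rightarrow> (nat \<Rightarrow> 'a::field mat) \<Rightarrow> 'a mat set" where
  "mat_span n d M = {mat_lincomb n d c M | c. True}"

definition mat_lin_indep :: "nat \<Rightarrow> nat \<Rightarrow> (nat \<Rightarrow> 'a::field mat) \<Rightarrow> bool" where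
  "mat_lin_indep n d M \<longleftrightarrow> (\<forall>c. mat_lincomb n d c M = 0\<^sub>m n n \<longrightarrow> (\<forall>j<d. c j = 0))"

(* The four Penrose conditions; mat_adjoint is the conjugate transpose. *)
definition is_pseudoinverse :: "'a::conjugatable_field mat \<Rightarrow> 'a mat \<Rightarrow> bool" where
  "is_pseudoinverse A X \<longleftrightarrow>
     X \<in> carrier_mat (dim_col A) (dim_row A) \<and>
     A * X * A = A \<and> X * A * X = X \<and>
     mat_adjoint (A * X) = A * X \<and> mat_adjoint (X * A) = X * A"

definition pseudoinverse :: "'a::conjugatable_field mat \<Rightarrow> 'a mat" where
  "pseudoinverse A = (THE X. is_pseudoinverse A X)"

(* scalar_prod does not conjugate, so this is the plain transpose form y^T A x. *)
definition bilinear_query :: "'a::field mat \<Rightarrow> 'a Matrix.vec \<Rightarrow> 'a Matrix.vec \<Rightarrow> 'a" where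
  "bilinear_query A x y = scalar_prod y (A *\<^sub>v x)"

definition query_matrix ::
  "nat \<Rightarrow> nat \<Rightarrow> nat \<Rightarrow> (nat \<Rightarrow> 'a::field mat) \<Rightarrow> (nat \<Rightarrow> nat \<Rightarrow> 'a) \<Rightarrow> (nat \<Rightarrow> nat \<Rightarrow> 'a) \<Rightarrow> 'a mat" where
  "query_matrix n d p M x y =
     mat p d (\<lambda>(i, j). bilinear_query (M j) (Matrix.vec n (x i)) (Matrix.vec n (y i)))"

definition query_response ::
  "nat \<Rightarrow> nat \<Rightarrow> 'a::field mat \<Rightarrow> (nat \<Rightarrow> nat \<Rightarrow> 'a) \<Rightarrow> (nat \<Rightarrow> nat \<Rightarrow> 'a) \<Rightarrow> 'a Matrix.vec" where
  "query_response n p B x y =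
     Matrix.vec p (\<lambda>i. bilinear_query B (Matrix.vec n (x i)) (Matrix.vec n (y i)))"

definition recovered_matrix ::
  "nat \<Rightarrow> nat \<Rightarrow> nat \<Rightarrow> (nat \<Rightarrow> 'a::conjugatable_field mat) \<Rightarrow> 'a mat \<Rightarrow>
   (nat \<Rightarrow> nat \<Rightarrow> 'a) \<Rightarrow> (nat \<Rightarrow> nat \<Rightarrow> 'a) \<Rightarrow> 'a mat" where
  "recovered_matrix n d p M B x y =
     mat_lincomb n d
       (vec_index (pseudoinverse (query_matrix n d p M x y) *\<^sub>v query_response n p B x y)) M"

(* The infimum is a minimum, since mat_span n d M is finite-dimensional. *)
definition best_approx_error ::
  "nat \<Rightarrow> nat \<Rightarrow> (nat \<Rightarrow> 'a::real_normed_field mat) \<Rightarrow> 'a mat \<Rightarrow> real" where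
  "best_approx_error n d M B = (INF A\<in>mat_span n d M. frobenius_norm (B - A))"

end

(*
  Let E be an orthonormal basis of the span F and R the component of B orthogonal to F.  The least
  squares solution satisfies |A u| <= |h|, where A is the query matrix, u the coefficient error and h the
  responses to R; Markov's inequality gives |h|^2 <= C p |R|^2.  It remains to bound
  sum_i |y_i^T N x_i|^2 from below by c p |N|^2, uniformly over N in F, with only p = O(d) queries.
  This is the small ball method: truncate t_N = Re (y^T N x) to min |t_N| 3, whose mean is bounded below because
  the second and fourth moments of t_N are comparable, and bound the expected maximal deviation over
  the unit sphere of F by O(sqrt (p d)) through symmetrization and contraction.  The event is
  measurable because the graph of the Moore-Penrose inverse is closed.
*)
theory Submission
  imports Defs
begin

text \<open>The obstacle is the order of \<open>p\<close>. For a single N the lower bound fails with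
  probability exp(-c p) only, but going from a net to the whole sphere by a union bound requires
  control of the operator norm of A. The answers are products of normals with heavy tails, and the
  easy second moment estimate is that of the Frobenius norm, of order sqrt (p d). It would force a
  mesh of order 1 / sqrt d and hence p of order d log d. Here a net only turns a supremum into a
  finite maximum, so its mesh can be as fine as this crude estimate demands.

  Normality enters only through mean zero, the variance v and a fourth moment of at most 3 v^2, a
  condition that is stable under independent sums. Both fields are treated at once: the common
  language is the real inner product Re (conj a * b), and the lower bound already holds for the real
  parts of the answers.

  The lower bound also makes A injective. On the good event the pseudoinverse therefore exists and
  is given by the normal equations.\<close>

no_notation scalar_prod (infix "\<bullet>" 70)

section \<open>Maxima of empirical processes\<close>

text \<open>If the maxima on the left are attained at \<open>c\<close> and \<open>c'\<close>, their
  sum depends on \<open>f\<close> only through \<open>f c - f c'\<close>, which is at most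
  \<open>\<bar>t c - t c'\<bar>\<close>. According to the sign of \<open>t c - t c'\<close>, the two
  points are then assigned to the two maxima on the right. This is the contraction principle for a
  single random sign.\<close>

lemma Max_add_Max_diff_contraction:
  fixes a f t :: "'c \<Rightarrow> real"
  assumes T: "finite T" "T \<noteq> {}"
    and f: "\<And>c c'. c \<in> T \<Longrightarrow> c' \<in> T \<Longrightarrow> \<bar>f c - f c'\<bar> \<le> \<bar>t c - t c'\<bar>"
  shows "(MAX c\<in>T. a c + f c) + (MAX c\<in>T. a c - f c)
    \<le> (MAX c\<in>T. a c + t c) + (MAX c\<in>T. a c - t c)"
proof -
  obtain c where c: "c \<in> T" "(MAX c\<in>T. a c + f c) = a c + f c"
    using Max_in[of "(\<lambda>c. a c + f c) ` T"] T by (metis (mono_tags, lifting) finite_imageI image_iff image_is_empty)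
  obtain c' where c': "c' \<in> T" "(MAX c\<in>T. a c - f c) = a c' - f c'"
    using Max_in[of "(\<lambda>c. a c - f c) ` T"] T by (metis (mono_tags, lifting) finite_imageI image_iff image_is_empty)
  have le: "a b + t b \<le> (MAX c\<in>T. a c + t c)" "a b - t b \<le> (MAX c\<in>T. a c - t c)" if "b \<in> T" for b
    using that T by (auto intro!: Max_ge)
  show ?thesis
    using f[OF c(1) c'(1)] le[OF c(1)] le[OF c'(1)] c(2) c'(2) by linarith
qed

context prob_space
begin

text \<open>Symmetrization, contraction and the passage from \<open>f\<close> to \<open>t\<close> happen in one step: averaging the
doubled function over the sign replaces a ghost sample. The quadratic bound of the next lemma then
reproduces itself by the parallelogram law, so that no Rademacher signs remain.\<close>

lemma symmetrization_step:
  fixes f t :: "'c \<Rightarrow> 'a \<Rightarrow> real" and a :: "'c \<Rightarrow> real"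
  assumes T: "finite T" "T \<noteq> {}"
    and f: "\<And>c c' x. c \<in> T \<Longrightarrow> c' \<in> T \<Longrightarrow> x \<in> space M \<Longrightarrow> \<bar>f c x - f c' x\<bar> \<le> \<bar>t c x - t c' x\<bar>"
    and int: "\<And>c. c \<in> T \<Longrightarrow> integrable M (f c)" "\<And>c. c \<in> T \<Longrightarrow> integrable M (t c)"
  shows "(\<integral>x. (MAX c\<in>T. a c + (f c x - expectation (f c))) \<partial>M)
    \<le> (\<integral>x. ((MAX c\<in>T. a c + 2 * t c x) + (MAX c\<in>T. a c - 2 * t c x)) / 2 \<partial>M)"
proof -
  have I: "integrable M (\<lambda>x. MAX c\<in>T. a c + 2 * f c x)" "integrable M (\<lambda>x. MAX c\<in>T. a c - 2 * f c x)"
    "integrable M (\<lambda>x. MAX c\<in>T. a c + 2 * t c x)" "integrable M (\<lambda>x. MAX c\<in>T. a c - 2 * t c x)"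
    "integrable M (\<lambda>x. MAX c\<in>T. a c + (f c x - expectation (f c)))"
    using int T by (auto intro!: integrable_MAX)
  \<comment> \<open>\<open>a c + (f c x - expectation (f c))\<close> is the average of
    \<open>a c + 2 * f c x\<close> and \<open>a c - 2 * expectation (f c)\<close>, so its maximum is
    at most the average of the two maxima. Jensen's inequality then moves the second maximum inside
    the integral. This is the origin of the factor 2.\<close>
  define m where "m = (MAX c\<in>T. a c - 2 * expectation (f c))"
  have m: "m \<le> (\<integral>x. (MAX c\<in>T. a c - 2 * f c x) \<partial>M)"
    unfolding m_def
  proof (subst Max_le_iff, safe)
    fix c assume c: "c \<in> T"
    have "a c - 2 * expectation (f c) = (\<integral>x. a c - 2 * f c x \<partial>M)"
      using int(1)[OF c] by (simp add: prob_space)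
    also have "\<dots> \<le> (\<integral>x. (MAX c\<in>T. a c - 2 * f c x) \<partial>M)"
      using int(1)[OF c] I c T by (intro integral_mono) (auto intro!: Max_ge)
    finally show "a c - 2 * expectation (f c) \<le> (\<integral>x. (MAX c\<in>T. a c - 2 * f c x) \<partial>M)" .
  qed (use T in auto)
  have "(\<integral>x. (MAX c\<in>T. a c + (f c x - expectation (f c))) \<partial>M)
      \<le> (\<integral>x. ((MAX c\<in>T. a c + 2 * f c x) + m) / 2 \<partial>M)"
  proof (intro integral_mono I)
    show "integrable M (\<lambda>x. ((MAX c\<in>T. a c + 2 * f c x) + m) / 2)" using I by simp
    fix x
    show "(MAX c\<in>T. a c + (f c x - expectation (f c))) \<le> ((MAX c\<in>T. a c + 2 * f c x) + m) / 2"
    proof (subst Max_le_iff, safe)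
      fix c assume c: "c \<in> T"
      have "a c + 2 * f c x \<le> (MAX c\<in>T. a c + 2 * f c x)" "a c - 2 * expectation (f c) \<le> m"
        unfolding m_def using c T by (auto intro!: Max_ge)
      then show "a c + (f c x - expectation (f c)) \<le> ((MAX c\<in>T. a c + 2 * f c x) + m) / 2" by simp
    qed (use T in auto)
  qed
  also have "\<dots> = ((\<integral>x. (MAX c\<in>T. a c + 2 * f c x) \<partial>M) + m) / 2"
    using I by (simp add: prob_space)
  also have "\<dots> \<le> (\<integral>x. ((MAX c\<in>T. a c + 2 * f c x) + (MAX c\<in>T. a c - 2 * f c x)) / 2 \<partial>M)"
    using I m by simp
  also have "\<dots> \<le> (\<integral>x. ((MAX c\<in>T. a c + 2 * t c x) + (MAX c\<in>T. a c - 2 * t c x)) / 2 \<partial>M)"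
  proof (rule integral_mono)
    fix x assume x: "x \<in> space M"
    show "((MAX c\<in>T. a c + 2 * f c x) + (MAX c\<in>T. a c - 2 * f c x)) / 2
       \<le> ((MAX c\<in>T. a c + 2 * t c x) + (MAX c\<in>T. a c - 2 * t c x)) / 2"
    proof (rule divide_right_mono[OF Max_add_Max_diff_contraction[OF T]])
      fix c c' assume "c \<in> T" "c' \<in> T"
      then show "\<bar>2 * f c x - 2 * f c' x\<bar> \<le> \<bar>2 * t c x - 2 * t c' x\<bar>"
        using f[OF _ _ x, of c c'] by linarith
    qed simp
  qed (use I in auto)
  finally show ?thesis .
qed

text \<open>The drift \<open>w\<close> is there for the induction on \<open>k\<close>: each
  symmetrized sample turns into a shift of \<open>w\<close>. Without samples the maximum is at most
  |w| by Cauchy-Schwarz. This is weakened to |w|^2 / (2 s) + s / 2, because a quadratic function of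
  \<open>w\<close> can be averaged exactly over opposite shifts. For \<open>w = 0\<close> the best
  \<open>s\<close> is the square root of 4 k times the expected sum of squares, and the bound is
  then equal to \<open>s\<close>.\<close>

lemma expectation_Max_empirical_process_le:
  fixes v :: "'a \<Rightarrow> nat \<Rightarrow> 'e::euclidean_space" and f :: "(nat \<Rightarrow> 'e) \<Rightarrow> 'a \<Rightarrow> real" and s b :: real and d :: nat
  defines "t \<equiv> \<lambda>c x. \<Sum>j<d. c j \<bullet> v x j"
  assumes T: "finite T" "T \<noteq> {}" "\<And>c. c \<in> T \<Longrightarrow> (\<Sum>j<d. (norm (c j))\<^sup>2) \<le> 1"
    and f: "\<And>c c' x. c \<in> T \<Longrightarrow> c' \<in> T \<Longrightarrow> x \<in> space M \<Longrightarrow> \<bar>f c x - f c' x\<bar> \<le> \<bar>t c x - t c' x\<bar>"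
    and f_meas[measurable]: "\<And>c. c \<in> T \<Longrightarrow> f c \<in> borel_measurable M"
    and f_bound: "\<And>c x. c \<in> T \<Longrightarrow> x \<in> space M \<Longrightarrow> \<bar>f c x\<bar> \<le> b"
    and v: "\<And>j. j < d \<Longrightarrow> integrable M (\<lambda>x. v x j)"
    and v2: "integrable M (\<lambda>x. \<Sum>j<d. (norm (v x j))\<^sup>2)"
    and s: "s > 0"
  shows "(\<integral>z. (MAX c\<in>T. (\<Sum>j<d. c j \<bullet> w j) + (\<Sum>i<k. f c (z i) - expectation (f c))) \<partial>(\<Pi>\<^sub>M i\<in>{..<k}. M))
    \<le> ((\<Sum>j<d. (norm (w j))\<^sup>2) + 4 * real k * expectation (\<lambda>x. \<Sum>j<d. (norm (v x j))\<^sup>2)) / (2 * s) + s / 2"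
proof (induction k arbitrary: w)
  case 0
  have "(MAX c\<in>T. \<Sum>j<d. c j \<bullet> w j) \<le> (\<Sum>j<d. (norm (w j))\<^sup>2) / (2 * s) + s / 2"
  proof (subst Max_le_iff, safe)
    fix c assume c: "c \<in> T"
    have "(\<Sum>j<d. c j \<bullet> w j) \<le> (\<Sum>j<d. (norm (w j))\<^sup>2 / (2 * s) + s * (norm (c j))\<^sup>2 / 2)"
    proof (rule sum_mono)
      fix j
      have "0 \<le> (norm (w j - s *\<^sub>R c j))\<^sup>2" by simp
      also have "\<dots> = (norm (w j))\<^sup>2 - 2 * s * (c j \<bullet> w j) + s\<^sup>2 * (norm (c j))\<^sup>2"
        unfolding power2_norm_eq_inner
        by (simp add: inner_diff_left inner_diff_right inner_commute power2_eq_square)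
      finally show "c j \<bullet> w j \<le> (norm (w j))\<^sup>2 / (2 * s) + s * (norm (c j))\<^sup>2 / 2"
        using s by (simp add: field_simps power2_eq_square)
    qed
    also have "\<dots> = (\<Sum>j<d. (norm (w j))\<^sup>2) / (2 * s) + s * (\<Sum>j<d. (norm (c j))\<^sup>2) / 2"
      by (simp add: sum.distrib sum_divide_distrib sum_distrib_left)
    also have "\<dots> \<le> (\<Sum>j<d. (norm (w j))\<^sup>2) / (2 * s) + s / 2"
      using T(3)[OF c] s by (simp add: mult_left_le)
    finally show "(\<Sum>j<d. c j \<bullet> w j) \<le> (\<Sum>j<d. (norm (w j))\<^sup>2) / (2 * s) + s / 2" .
  qed (use T in auto)
  moreover have "prob_space (\<Pi>\<^sub>M i\<in>{..<0::nat}. M)"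
    by (intro prob_space_PiM prob_space_axioms)
  ultimately show ?case
    by (simp del: lessThan_0 add: prob_space.prob_space) (simp add: prob_space.prob_space)
next
  case (Suc k)
  let ?P = "\<Pi>\<^sub>M i\<in>{..<k}. M"
  define e where "e c = expectation (f c)" for c
  define \<sigma> where "\<sigma> = expectation (\<lambda>x. \<Sum>j<d. (norm (v x j))\<^sup>2)"
  define A where "A w c z = (\<Sum>j<d. c j \<bullet> w j) + (\<Sum>i<k. f c (z i) - e c)" for w c z
  define B where "B w = ((\<Sum>j<d. (norm (w j))\<^sup>2) + 4 * real k * \<sigma>) / (2 * s) + s / 2" for w :: "nat \<Rightarrow> 'e"
  interpret P: prob_space ?P by (intro prob_space_PiM prob_space_axioms)
  interpret Q: pair_sigma_finite M ?P by standard
  interpret MP: prob_space "M \<Otimes>\<^sub>M ?P" by (intro prob_space_pair) (simp_all add: prob_space_axioms P.prob_space_axioms)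
  have t_int: "integrable M (t c)" for c
    unfolding t_def using v by (intro Bochner_Integration.integrable_sum integrable_inner_right) auto
  have t_meas[measurable]: "t c \<in> borel_measurable M" for c using t_int by auto
  have f_int: "integrable M (f c)" if "c \<in> T" for c
    using f_bound[OF that] f_meas[OF that] by (intro integrable_const_bound[of _ b]) auto
  have A_meas[measurable]: "A w c \<in> borel_measurable ?P" if "c \<in> T" for w c
    using f_meas[OF that] unfolding A_def by measurable
  have A_bound: "norm (A w c z) \<le> norm (\<Sum>j<d. c j \<bullet> w j) + k * (b + \<bar>e c\<bar>)"
    if c: "c \<in> T" and z: "z \<in> space ?P" for w c z
  proof -
    have "norm (\<Sum>i<k. f c (z i) - e c) \<le> (\<Sum>i<k. b + \<bar>e c\<bar>)"
    proof (rule order.trans[OF norm_sum sum_mono])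
      fix i assume "i \<in> {..<k}"
      then have "z i \<in> space M" using z by (auto simp: space_PiM)
      then show "norm (f c (z i) - e c) \<le> b + \<bar>e c\<bar>" using f_bound[OF c, of "z i"] by simp
    qed
    then show ?thesis unfolding A_def by (intro order.trans[OF norm_triangle_ineq] add_left_mono) simp
  qed
  have A_int: "integrable (M \<Otimes>\<^sub>M ?P) (\<lambda>(x, z). A w c z)" if c: "c \<in> T" for w c
  proof (rule MP.integrable_const_bound[OF AE_I2])
    show "norm (case p of (x, z) \<Rightarrow> A w c z) \<le> norm (\<Sum>j<d. c j \<bullet> w j) + k * (b + \<bar>e c\<bar>)"
      if "p \<in> space (M \<Otimes>\<^sub>M ?P)" for p
      using that A_bound[OF c, of "snd p" w] by (cases p) (simp add: space_pair_measure)
    show "(\<lambda>(x, z). A w c z) \<in> borel_measurable (M \<Otimes>\<^sub>M ?P)" using c by measurable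
  qed
  have fst_int: "integrable (M \<Otimes>\<^sub>M ?P) (\<lambda>(x, z). g x)" if "integrable M g" for g :: "'a \<Rightarrow> real"
  proof -
    have "integrable (distr (M \<Otimes>\<^sub>M ?P) M fst) g" using that by (simp add: P.distr_pair_fst)
    then show ?thesis by (subst (asm) integrable_distr_eq) (use that in \<open>auto simp: split_beta'\<close>)
  qed
  have int1: "integrable (M \<Otimes>\<^sub>M ?P) (\<lambda>(x, z). MAX c\<in>T. A w c z + (f c x - e c))"
    using T A_int[of _ w] fst_int[OF f_int]
    unfolding split_beta'
    by (intro integrable_MAX Bochner_Integration.integrable_add Bochner_Integration.integrable_diff
        MP.integrable_const) blast+
  have int2: "integrable (M \<Otimes>\<^sub>M ?P) (\<lambda>(x, z). MAX c\<in>T. A w c z + 2 * t c x)"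
    "integrable (M \<Otimes>\<^sub>M ?P) (\<lambda>(x, z). MAX c\<in>T. A w c z - 2 * t c x)"
    using T A_int[of _ w] fst_int[OF t_int]
    unfolding split_beta'
    by (intro integrable_MAX Bochner_Integration.integrable_add Bochner_Integration.integrable_diff
        integrable_mult_right; blast)+
  have int3: "integrable (M \<Otimes>\<^sub>M ?P)
      (\<lambda>(x, z). ((MAX c\<in>T. A w c z + 2 * t c x) + (MAX c\<in>T. A w c z - 2 * t c x)) / 2)"
    using int2 by (auto simp: split_beta')
  \<comment> \<open>The doubled linear term of the new sample is absorbed into the drift, so the
    induction hypothesis applies at both shifted drifts.\<close>
  have A_shift: "A w c z + 2 * t c x = A (\<lambda>j. w j + 2 *\<^sub>R v x j) c z"
    "A w c z - 2 * t c x = A (\<lambda>j. w j - 2 *\<^sub>R v x j) c z" for c z x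
    unfolding A_def t_def by (simp_all add: inner_add_right inner_diff_right sum.distrib sum_subtractf sum_distrib_left)
  have IH: "(\<integral>z. (MAX c\<in>T. A w c z) \<partial>?P) \<le> B w" for w
    using Suc.IH[of w] unfolding A_def B_def \<sigma>_def e_def .
  have intP: "integrable ?P (\<lambda>z. MAX c\<in>T. A w c z)" for w
    using T by (intro integrable_MAX P.integrable_const_bound[OF AE_I2[OF A_bound]]) auto
  \<comment> \<open>The cross terms of the two shifts cancel. After halving, a sample contributes
    four times its sum of squares to the numerator, which is the 4 in the bound.\<close>
  have para: "B (\<lambda>j. w j + 2 *\<^sub>R v x j) + B (\<lambda>j. w j - 2 *\<^sub>R v x j)
      = 2 * B w + 4 / s * (\<Sum>j<d. (norm (v x j))\<^sup>2)" for x
  proof -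
    have "(\<Sum>j<d. (norm (w j + 2 *\<^sub>R v x j))\<^sup>2) + (\<Sum>j<d. (norm (w j - 2 *\<^sub>R v x j))\<^sup>2)
        = 2 * (\<Sum>j<d. (norm (w j))\<^sup>2) + 8 * (\<Sum>j<d. (norm (v x j))\<^sup>2)"
      unfolding sum.distrib[symmetric] sum_distrib_left power2_norm_eq_inner
      by (intro sum.cong) (auto simp: inner_add_left inner_add_right inner_diff_left inner_diff_right inner_commute)
    moreover have "(a + r) / (2 * s) + s / 2 + ((a' + r) / (2 * s) + s / 2) = 2 * ((u + r) / (2 * s) + s / 2) + 4 / s * q"
      if "a + a' = 2 * u + 8 * q" for a a' u q r :: real
    proof -
      have "(a + r) / (2 * s) + s / 2 + ((a' + r) / (2 * s) + s / 2) = (a + a' + 2 * r) / (2 * s) + s"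
        by (simp add: add_divide_distrib)
      then show ?thesis unfolding that using s by (simp add: field_simps)
    qed
    ultimately show ?thesis unfolding B_def by blast
  qed
  have "(\<integral>z. (MAX c\<in>T. (\<Sum>j<d. c j \<bullet> w j) + (\<Sum>i<Suc k. f c (z i) - e c)) \<partial>(\<Pi>\<^sub>M i\<in>{..<Suc k}. M))
     = (\<integral>z. (MAX c\<in>T. (\<Sum>j<d. c j \<bullet> w j) + (\<Sum>i<Suc k. f c (z i) - e c))
          \<partial>distr (M \<Otimes>\<^sub>M ?P) (\<Pi>\<^sub>M i\<in>{..<Suc k}. M) (\<lambda>(x, X). X(k := x)))"
    using distr_pair_PiM_eq_PiM[of "{..<k}" "\<lambda>_. M" k] by (simp add: lessThan_Suc prob_space_axioms)
  also have "\<dots> = (\<integral>p. (MAX c\<in>T. (\<Sum>j<d. c j \<bullet> w j) + (\<Sum>i<Suc k. f c (((snd p)(k := fst p)) i) - e c)) \<partial>(M \<Otimes>\<^sub>M ?P))"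
    using T by (subst integral_distr) (auto simp: lessThan_Suc split_beta')
  also have "\<dots> = (\<integral>(x, z). (MAX c\<in>T. A w c z + (f c x - e c)) \<partial>(M \<Otimes>\<^sub>M ?P))"
    by (intro Bochner_Integration.integral_cong refl) (auto simp: A_def algebra_simps intro!: arg_cong[where f=Max] image_cong)
  also have "\<dots> = (\<integral>z. (\<integral>x. (MAX c\<in>T. A w c z + (f c x - e c)) \<partial>M) \<partial>?P)"
    by (rule Q.integral_snd[OF int1, symmetric])
  \<comment> \<open>The old samples \<open>z\<close> are frozen and \<open>A w c z\<close> plays the
    part of the offset \<open>a c\<close>, so only the new sample \<open>x\<close> is symmetrized
    here.\<close>
  also have "\<dots> \<le> (\<integral>z. (\<integral>x. ((MAX c\<in>T. A w c z + 2 * t c x) + (MAX c\<in>T. A w c z - 2 * t c x)) / 2 \<partial>M) \<partial>?P)"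
    unfolding e_def
    by (intro integral_mono Q.integrable_snd[OF int1, unfolded e_def] Q.integrable_snd[OF int3]
        symmetrization_step T f f_int t_int) auto
  also have "\<dots> = (\<integral>x. (\<integral>z. ((MAX c\<in>T. A w c z + 2 * t c x) + (MAX c\<in>T. A w c z - 2 * t c x)) / 2 \<partial>?P) \<partial>M)"
    by (rule Q.Fubini_integral[OF int3])
  also have "\<dots> \<le> (\<integral>x. (B (\<lambda>j. w j + 2 *\<^sub>R v x j) + B (\<lambda>j. w j - 2 *\<^sub>R v x j)) / 2 \<partial>M)"
  proof (intro integral_mono Q.integrable_fst[OF int3])
    show "integrable M (\<lambda>x. (B (\<lambda>j. w j + 2 *\<^sub>R v x j) + B (\<lambda>j. w j - 2 *\<^sub>R v x j)) / 2)"
      unfolding para using v2 by simp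
    fix x
    have "(\<integral>z. ((MAX c\<in>T. A w c z + 2 * t c x) + (MAX c\<in>T. A w c z - 2 * t c x)) / 2 \<partial>?P)
      = ((\<integral>z. (MAX c\<in>T. A (\<lambda>j. w j + 2 *\<^sub>R v x j) c z) \<partial>?P) + (\<integral>z. (MAX c\<in>T. A (\<lambda>j. w j - 2 *\<^sub>R v x j) c z) \<partial>?P)) / 2"
      unfolding A_shift using intP by simp
    also have "\<dots> \<le> (B (\<lambda>j. w j + 2 *\<^sub>R v x j) + B (\<lambda>j. w j - 2 *\<^sub>R v x j)) / 2"
      by (intro divide_right_mono add_mono IH) simp
    finally show "(\<integral>z. ((MAX c\<in>T. A w c z + 2 * t c x) + (MAX c\<in>T. A w c z - 2 * t c x)) / 2 \<partial>?P)
      \<le> (B (\<lambda>j. w j + 2 *\<^sub>R v x j) + B (\<lambda>j. w j - 2 *\<^sub>R v x j)) / 2" .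
  qed
  also have "\<dots> = B w + 2 / s * \<sigma>"
    unfolding para \<sigma>_def using v2 by (simp add: prob_space field_simps)
  also have "\<dots> = ((\<Sum>j<d. (norm (w j))\<^sup>2) + 4 * real (Suc k) * \<sigma>) / (2 * s) + s / 2"
    using s unfolding B_def by (simp add: field_simps)
  finally show ?case unfolding e_def \<sigma>_def .
qed

end

section \<open>Real and complex scalars\<close>


text \<open>The common interface of the two fields. \<open>inner_mult\<close> says that
  multiplication by \<open>b\<close> has multiplication by its conjugate as adjoint for the real
  inner product. \<open>Basis_card_le\<close> guarantees that the real part of an answer keeps at
  least half of its second moment.\<close>

class real_or_complex = real_normed_field + euclidean_space + conjugatable_field +
  assumes inner_mult: "inner a (b * c) = inner (conjugate b * a) c"
    and conjugate_mult_self: "conjugate a * a = ((norm a)\<^sup>2) *\<^sub>R 1"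
    and Basis_card_le: "card Basis \<le> 2"

instance real :: real_or_complex
  by standard (auto simp: power2_eq_square)

instance complex :: real_or_complex
proof
  show "card (Basis :: complex set) \<le> 2" by simp
next
  fix a :: complex
  show "conjugate a * a = ((norm a)\<^sup>2) *\<^sub>R 1"
    unfolding cmod_power2 by (simp add: complex_eq_iff power2_eq_square)
qed (simp add: inner_complex_def algebra_simps)

lemma norm_conjugate [simp]: "norm (conjugate a :: 'a::real_or_complex) = norm a"
proof (cases "a = 0")
  case False
  have "norm (conjugate a) * norm a = (norm a)\<^sup>2"
    using arg_cong[OF conjugate_mult_self[of a], of norm] by (simp add: norm_mult)
  then show ?thesis using False by (simp add: power2_eq_square)
qed simp

section \<open>Moments of bilinear forms in normal vectors\<close>

lemma integrable_fourth_powerD: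
  fixes X :: "'b \<Rightarrow> real"
  assumes "finite_measure M" "X \<in> borel_measurable M" "integrable M (\<lambda>x. X x ^ 4)" "k \<le> 4"
  shows "integrable M (\<lambda>x. X x ^ k)"
proof (rule Bochner_Integration.integrable_bound)
  interpret finite_measure M by fact
  show "integrable M (\<lambda>x. 1 + X x ^ 4)" using assms by simp
  show "(\<lambda>x. X x ^ k) \<in> borel_measurable M" using assms by simp
  show "AE x in M. norm (X x ^ k) \<le> norm (1 + X x ^ 4)"
  proof (rule AE_I2)
    fix x
    have "\<bar>X x\<bar> ^ k \<le> 1 + \<bar>X x\<bar> ^ 4"
    proof (cases "\<bar>X x\<bar> \<le> 1")
      case True
      then show ?thesis using power_le_one[of "\<bar>X x\<bar>" k] by (smt (verit) abs_ge_zero zero_le_power)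
    next
      case False
      then show ?thesis using power_increasing[OF assms(4), of "\<bar>X x\<bar>"] by simp
    qed
    then show "norm (X x ^ k) \<le> norm (1 + X x ^ 4)"
      by (simp add: power_abs power_even_abs)
  qed
qed

lemma
  fixes f :: "'b \<Rightarrow> real" and g :: "'c \<Rightarrow> real"
  assumes "prob_space A" "prob_space B" and f: "integrable A f" and g: "integrable B g"
  shows integrable_pair_mult: "integrable (A \<Otimes>\<^sub>M B) (\<lambda>(x, y). f x * g y)"
    and integral_pair_mult: "(\<integral>(x, y). f x * g y \<partial>(A \<Otimes>\<^sub>M B)) = integral\<^sup>L A f * integral\<^sup>L B g"
proof -
  interpret A: prob_space A by fact
  interpret B: prob_space B by fact
  interpret pair_sigma_finite A B ..
  have [measurable]: "f \<in> borel_measurable A" "g \<in> borel_measurable B" using f g by auto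
  show *: "integrable (A \<Otimes>\<^sub>M B) (\<lambda>(x, y). f x * g y)"
  proof (rule Fubini_integrable)
    show "integrable A (\<lambda>x. \<integral>y. norm (case (x, y) of (x, y) \<Rightarrow> f x * g y) \<partial>B)"
      using f g by (simp add: abs_mult)
  qed (use g in auto)
  show "(\<integral>(x, y). f x * g y \<partial>(A \<Otimes>\<^sub>M B)) = integral\<^sup>L A f * integral\<^sup>L B g"
    by (subst integral_fst[OF *, symmetric]) simp
qed

text \<open>What is kept of a centred normal law. The 3 is the Gaussian ratio of the fourth moment
  to the squared variance. With an inequality in its place, forms can be handled by moment
  calculations alone, without identifying their laws.\<close>

definition normal_moments :: "'b measure \<Rightarrow> ('b \<Rightarrow> real) \<Rightarrow> real \<Rightarrow> bool" where
  "normal_moments M X v \<longleftrightarrow> X \<in> borel_measurable M \<and> integrable M (\<lambda>x. X x ^ 4) \<and>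
     (\<integral>x. X x \<partial>M) = 0 \<and> (\<integral>x. (X x)\<^sup>2 \<partial>M) = v \<and> (\<integral>x. X x ^ 4 \<partial>M) \<le> 3 * v\<^sup>2"

lemma normal_moments_zero: "prob_space M \<Longrightarrow> normal_moments M (\<lambda>_. 0) 0"
  by (simp add: normal_moments_def)

lemma normal_moments_distr:
  assumes [measurable]: "f \<in> measurable M N" "X \<in> borel_measurable N"
  shows "normal_moments (distr M N f) X v \<longleftrightarrow> normal_moments M (\<lambda>x. X (f x)) v"
  unfolding normal_moments_def by (simp add: integral_distr integrable_distr_eq)

text \<open>In the expansion of the fourth power the terms of odd degree vanish by independence and
  zero means. The remaining mixed term 6 u v is exactly what completes 3 u^2 + 3 v^2 to 3 (u + v)^2,
  so the constant 3 does not deteriorate.\<close>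

lemma normal_moments_add:
  assumes "prob_space A" "prob_space B" and X: "normal_moments A X u" and Y: "normal_moments B Y v"
  shows "normal_moments (A \<Otimes>\<^sub>M B) (\<lambda>(x, y). X x + Y y) (u + v)"
proof -
  interpret A: prob_space A by fact
  interpret B: prob_space B by fact
  have [measurable]: "X \<in> borel_measurable A" "Y \<in> borel_measurable B"
    using X Y by (auto simp: normal_moments_def)
  have iX: "integrable A (\<lambda>x. X x ^ k)" if "k \<le> 4" for k
    using integrable_fourth_powerD[OF A.finite_measure_axioms _ _ that] X by (auto simp: normal_moments_def)
  have iY: "integrable B (\<lambda>x. Y x ^ k)" if "k \<le> 4" for k
    using integrable_fourth_powerD[OF B.finite_measure_axioms _ _ that] Y by (auto simp: normal_moments_def)
  let ?m = "\<lambda>k l (x, y). X x ^ k * Y y ^ l"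
  have i: "integrable (A \<Otimes>\<^sub>M B) (?m k l)" if "k \<le> 4" "l \<le> 4" for k l
    using integrable_pair_mult[OF assms(1,2) iX iY] that by blast
  have e: "integral\<^sup>L (A \<Otimes>\<^sub>M B) (?m k l) = (\<integral>x. X x ^ k \<partial>A) * (\<integral>y. Y y ^ l \<partial>B)" if "k \<le> 4" "l \<le> 4" for k l
    using integral_pair_mult[OF assms(1,2) iX iY] that by blast
  have eX: "(\<integral>x. X x ^ 0 \<partial>A) = 1" "(\<integral>x. X x ^ 1 \<partial>A) = 0" "(\<integral>x. X x ^ 2 \<partial>A) = u" "(\<integral>x. X x ^ 4 \<partial>A) \<le> 3 * u\<^sup>2"
    using X by (auto simp: normal_moments_def A.prob_space)
  have eY: "(\<integral>x. Y x ^ 0 \<partial>B) = 1" "(\<integral>x. Y x ^ 1 \<partial>B) = 0" "(\<integral>x. Y x ^ 2 \<partial>B) = v" "(\<integral>x. Y x ^ 4 \<partial>B) \<le> 3 * v\<^sup>2"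
    using Y by (auto simp: normal_moments_def B.prob_space)
  have p1: "(case p of (x, y) \<Rightarrow> X x + Y y) = ?m 1 0 p + ?m 0 1 p" for p by (cases p) simp
  have p2: "(case p of (x, y) \<Rightarrow> X x + Y y) ^ 2 = ?m 2 0 p + 2 * ?m 1 1 p + ?m 0 2 p" for p
    by (cases p) (simp add: power2_eq_square algebra_simps)
  have p4: "(case p of (x, y) \<Rightarrow> X x + Y y) ^ 4
      = ?m 4 0 p + 4 * ?m 3 1 p + 6 * ?m 2 2 p + 4 * ?m 1 3 p + ?m 0 4 p" for p
    by (cases p) (simp add: power4_eq_xxxx power3_eq_cube power2_eq_square algebra_simps)
  show ?thesis
    unfolding normal_moments_def
  proof (intro conjI)
    show "integrable (A \<Otimes>\<^sub>M B) (\<lambda>p. (case p of (x, y) \<Rightarrow> X x + Y y) ^ 4)"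
      unfolding p4 by (intro Bochner_Integration.integrable_add integrable_mult_right i) simp_all
    show "(\<integral>p. (case p of (x, y) \<Rightarrow> X x + Y y) \<partial>(A \<Otimes>\<^sub>M B)) = 0"
      unfolding p1 using i[of 1 0] i[of 0 1] e[of 1 0] e[of 0 1] eX eY by simp
    show "(\<integral>p. (case p of (x, y) \<Rightarrow> X x + Y y) ^ 2 \<partial>(A \<Otimes>\<^sub>M B)) = u + v"
      unfolding p2 using i[of 2 0] i[of 1 1] i[of 0 2] e[of 2 0] e[of 1 1] e[of 0 2] eX eY by simp
    have "(\<integral>p. (case p of (x, y) \<Rightarrow> X x + Y y) ^ 4 \<partial>(A \<Otimes>\<^sub>M B))
        = (\<integral>x. X x ^ 4 \<partial>A) + 6 * u * v + (\<integral>y. Y y ^ 4 \<partial>B)"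
      unfolding p4 using i[of 4 0] i[of 3 1] i[of 2 2] i[of 1 3] i[of 0 4]
        e[of 4 0] e[of 3 1] e[of 2 2] e[of 1 3] e[of 0 4] eX(1-3) eY(1-3) by simp
    also have "\<dots> \<le> 3 * u\<^sup>2 + 6 * u * v + 3 * v\<^sup>2"
      using eX eY by simp
    also have "\<dots> = 3 * (u + v)\<^sup>2" by (simp add: power2_sum algebra_simps)
    finally show "(\<integral>p. (case p of (x, y) \<Rightarrow> X x + Y y) ^ 4 \<partial>(A \<Otimes>\<^sub>M B)) \<le> 3 * (u + v)\<^sup>2" .
  qed simp
qed

text \<open>The \<open>X j\<close> may be dependent. Each mixed moment of squares is at most 3 s_i
  s_j by Cauchy-Schwarz, here in the form of Young's inequality with an optimal weight. It is
  applied to the real coordinates of the vector A x, whose squared length is the conditional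
  variance of y^T A x up to the dimension of the field.\<close>

lemma normal_moments_sum_squares:
  assumes "prob_space M" "finite J" and X: "\<And>j. j \<in> J \<Longrightarrow> normal_moments M (X j) (s j)"
  shows "integrable M (\<lambda>x. (\<Sum>j\<in>J. (X j x)\<^sup>2)\<^sup>2)"
    and "(\<integral>x. (\<Sum>j\<in>J. (X j x)\<^sup>2)\<^sup>2 \<partial>M) \<le> 3 * (\<Sum>j\<in>J. s j)\<^sup>2"
proof -
  interpret prob_space M by fact
  have XD: "X j \<in> borel_measurable M" "integrable M (\<lambda>x. X j x ^ 4)" "(\<integral>x. (X j x)\<^sup>2 \<partial>M) = s j"
    "(\<integral>x. X j x ^ 4 \<partial>M) \<le> 3 * (s j)\<^sup>2" if "j \<in> J" for j
    using X[OF that] by (auto simp: normal_moments_def)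
  have s: "s j \<ge> 0" if "j \<in> J" for j
    using XD(3)[OF that] by (metis integral_nonneg_AE AE_I2 zero_le_power2)
  have young: "(X i x)\<^sup>2 * (X j x)\<^sup>2 \<le> (l * X i x ^ 4 + X j x ^ 4 / l) / 2" if "l > 0" for i j x l
  proof -
    have "0 \<le> (l * (X i x)\<^sup>2 - (X j x)\<^sup>2)\<^sup>2 / l" using that by simp
    also have "\<dots> = l * X i x ^ 4 - 2 * (X i x)\<^sup>2 * (X j x)\<^sup>2 + X j x ^ 4 / l"
      using that by (simp add: power2_eq_square power4_eq_xxxx field_simps)
    finally show ?thesis by simp
  qed
  have int: "integrable M (\<lambda>x. (X i x)\<^sup>2 * (X j x)\<^sup>2)" if "i \<in> J" "j \<in> J" for i j
  proof (rule Bochner_Integration.integrable_bound)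
    show "integrable M (\<lambda>x. (1 * X i x ^ 4 + X j x ^ 4 / 1) / 2)" using XD that by simp
    show "(\<lambda>x. (X i x)\<^sup>2 * (X j x)\<^sup>2) \<in> borel_measurable M" using XD that by simp
    show "AE x in M. norm ((X i x)\<^sup>2 * (X j x)\<^sup>2) \<le> norm ((1 * X i x ^ 4 + X j x ^ 4 / 1) / 2)"
      using young[of 1 i _ j] by (intro AE_I2) simp
  qed
  have le: "(\<integral>x. (X i x)\<^sup>2 * (X j x)\<^sup>2 \<partial>M) \<le> 3 * s i * s j" if ij: "i \<in> J" "j \<in> J" for i j
  proof -
    \<comment> \<open>The optimal weight below is a quotient of variances, so degenerate variables
      are treated apart.\<close>
    have zero: "AE x in M. X k x = 0" if "s k = 0" "k \<in> J" for k
    proof -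
      have "(\<integral>x. (X k x)\<^sup>2 \<partial>M) = 0" using XD(3) that by simp
      then have "AE x in M. (X k x)\<^sup>2 = 0"
        using integrable_fourth_powerD[OF finite_measure_axioms XD(1,2)[OF that(2)], of 2]
        by (subst (asm) integral_nonneg_eq_0_iff_AE) auto
      then show ?thesis by simp
    qed
    consider "s i = 0" | "s j = 0" | "s i > 0" "s j > 0" using s ij by force
    then show ?thesis
    proof cases
      case 1
      then have "AE x in M. (X i x)\<^sup>2 * (X j x)\<^sup>2 = 0" using zero[OF 1 ij(1)] by auto
      then have "(\<integral>x. (X i x)\<^sup>2 * (X j x)\<^sup>2 \<partial>M) = (\<integral>x. 0 \<partial>M)" using XD ij by (intro integral_cong_AE) auto
      then show ?thesis using 1 by simp
    next
      case 2
      then have "AE x in M. (X i x)\<^sup>2 * (X j x)\<^sup>2 = 0" using zero[OF 2 ij(2)] by auto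
      then have "(\<integral>x. (X i x)\<^sup>2 * (X j x)\<^sup>2 \<partial>M) = (\<integral>x. 0 \<partial>M)" using XD ij by (intro integral_cong_AE) auto
      then show ?thesis using 2 by simp
    next
      case 3
      \<comment> \<open>This weight minimizes 3 (l s_i^2 + s_j^2 / l) / 2, with minimum 3 s_i
        s_j.\<close>
      define l where "l = s j / s i"
      have l: "l > 0" using 3 by (simp add: l_def)
      have "(\<integral>x. (X i x)\<^sup>2 * (X j x)\<^sup>2 \<partial>M) \<le> (\<integral>x. (l * X i x ^ 4 + X j x ^ 4 / l) / 2 \<partial>M)"
        using XD ij by (intro integral_mono int young l) auto
      also have "\<dots> = (l * (\<integral>x. X i x ^ 4 \<partial>M) + (\<integral>x. X j x ^ 4 \<partial>M) / l) / 2"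
        using XD ij by simp
      also have "\<dots> \<le> (l * (3 * (s i)\<^sup>2) + (3 * (s j)\<^sup>2) / l) / 2"
        using XD ij l by (intro divide_right_mono add_mono mult_left_mono) auto
      also have "\<dots> = 3 * s i * s j" using 3 by (simp add: l_def field_simps power2_eq_square)
      finally show ?thesis .
    qed
  qed
  have sq: "(\<Sum>j\<in>J. (X j x)\<^sup>2)\<^sup>2 = (\<Sum>i\<in>J. \<Sum>j\<in>J. (X i x)\<^sup>2 * (X j x)\<^sup>2)" for x
    by (simp add: power2_eq_square sum_product)
  show "integrable M (\<lambda>x. (\<Sum>j\<in>J. (X j x)\<^sup>2)\<^sup>2)"
    unfolding sq by (intro Bochner_Integration.integrable_sum int)
  have "(\<integral>x. (\<Sum>j\<in>J. (X j x)\<^sup>2)\<^sup>2 \<partial>M) = (\<Sum>i\<in>J. \<Sum>j\<in>J. (\<integral>x. (X i x)\<^sup>2 * (X j x)\<^sup>2 \<partial>M))"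
    unfolding sq using int by simp
  also have "\<dots> \<le> (\<Sum>i\<in>J. \<Sum>j\<in>J. 3 * s i * s j)" by (intro sum_mono le)
  also have "\<dots> = 3 * (\<Sum>j\<in>J. s j)\<^sup>2" by (simp add: power2_eq_square sum_product[of s J s J] sum_distrib_left[of 3] mult.assoc)
  finally show "(\<integral>x. (\<Sum>j\<in>J. (X j x)\<^sup>2)\<^sup>2 \<partial>M) \<le> 3 * (\<Sum>j\<in>J. s j)\<^sup>2" .
qed

lemma normal_moments_nn_integral:
  assumes "prob_space M" "normal_moments M X v"
  shows "(\<integral>\<^sup>+x. ennreal ((X x)\<^sup>2) \<partial>M) = ennreal v" "(\<integral>\<^sup>+x. ennreal (X x ^ 4) \<partial>M) \<le> ennreal (3 * v\<^sup>2)"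
proof -
  interpret prob_space M by fact
  have X: "X \<in> borel_measurable M" "integrable M (\<lambda>x. X x ^ 4)" "(\<integral>x. (X x)\<^sup>2 \<partial>M) = v" "(\<integral>x. X x ^ 4 \<partial>M) \<le> 3 * v\<^sup>2"
    using assms by (auto simp: normal_moments_def)
  show "(\<integral>\<^sup>+x. ennreal ((X x)\<^sup>2) \<partial>M) = ennreal v"
    using integrable_fourth_powerD[OF finite_measure_axioms X(1,2), of 2] X(3)
    by (subst nn_integral_eq_integral) auto
  show "(\<integral>\<^sup>+x. ennreal (X x ^ 4) \<partial>M) \<le> ennreal (3 * v\<^sup>2)"
    using X by (subst nn_integral_eq_integral) auto
qed

lemma inner_mult_conjugate: "inner u (y * b) = inner (conjugate b * u) (y :: 'a::real_or_complex)"
  by (simp add: mult.commute[of y b] inner_mult)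

lemma inner_mult_left: "inner (b * c) u = inner (conjugate b * u) (c :: 'a::real_or_complex)"
  by (metis inner_commute inner_mult)

text \<open>The form y^T A x, with the matrix given as a function of index pairs. Linear
  combinations of matrices are then pointwise and need no carrier conditions.\<close>

definition array_form :: "nat \<Rightarrow> (nat \<times> nat \<Rightarrow> 'a::real_or_complex) \<Rightarrow> (nat \<Rightarrow> 'a) \<Rightarrow> (nat \<Rightarrow> 'a) \<Rightarrow> 'a" where
  "array_form n A x y = (\<Sum>k<n. y k * (\<Sum>l<n. A (k, l) * x l))"

definition array_sqnorm :: "nat \<Rightarrow> (nat \<times> nat \<Rightarrow> 'a::real_or_complex) \<Rightarrow> real" where
  "array_sqnorm n A = (\<Sum>k<n. \<Sum>l<n. (norm (A (k, l)))\<^sup>2)"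

text \<open>The squared modulus is split along the real basis. Each summand is the square of a real
  linear form in \<open>x\<close>, the shape covered by
  \<open>normal_moments_linear_form\<close>.\<close>

lemma norm_square_linear_combination:
  fixes a x :: "nat \<Rightarrow> 'a::real_or_complex"
  shows "(norm (\<Sum>l<n. a l * x l))\<^sup>2 = (\<Sum>w\<in>Basis. (\<Sum>l<n. inner (conjugate (a l) * w) (x l))\<^sup>2)"
  by (subst power2_norm_eq_inner, subst euclidean_inner)
    (simp add: inner_sum_left inner_mult_left[of "a _"] power2_eq_square)

lemma array_sqnorm_nonneg: "array_sqnorm n A \<ge> 0"
  unfolding array_sqnorm_def by (intro sum_nonneg) simp

text \<open>All that is used of the scalar law. The division by \<open>DIM('a)\<close> reflects that
  a complex standard normal has variance 1/2 in each real direction, a real one variance 1.\<close>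

locale normal_scalar = prob_space N for N :: "'a::real_or_complex measure" +
  assumes sets_N [measurable_cong]: "sets N = sets borel"
    and normal_moments_inner: "normal_moments N (inner a) ((norm a)\<^sup>2 / DIM('a))"
begin

abbreviation vector_law :: "nat \<Rightarrow> (nat \<Rightarrow> 'a) measure" where
  "vector_law n \<equiv> std_normal_vector N n"

lemma prob_space_vector_law: "prob_space (vector_law n)"
  unfolding std_normal_vector_def by (intro prob_space_PiM prob_space_axioms)

lemma measurable_vector_law_component [measurable]: "k < n \<Longrightarrow> (\<lambda>x. x k) \<in> borel_measurable (vector_law n)"
  unfolding std_normal_vector_def measurable_cong_sets[OF refl sets_N, symmetric]
  by (rule measurable_component_singleton) simp

lemma normal_moments_linear_form:
  "normal_moments (vector_law n) (\<lambda>x. \<Sum>k<n. inner (a k) (x k)) (\<Sum>k<n. (norm (a k))\<^sup>2 / DIM('a))"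
proof (induction n)
  case 0
  then show ?case using normal_moments_zero[OF prob_space_vector_law, of 0] by simp
next
  case (Suc n)
  have m: "(\<lambda>x. inner (a n) (x n) + (\<Sum>k<n. inner (a k) (x k))) \<in> borel_measurable (vector_law (Suc n))"
    by measurable
  have S_Suc: "vector_law (Suc n) = distr (N \<Otimes>\<^sub>M vector_law n) (vector_law (Suc n)) (\<lambda>(x, X). X(n := x))"
    unfolding std_normal_vector_def lessThan_Suc
    by (intro distr_pair_PiM_eq_PiM[symmetric] prob_space_axioms)
  have f: "(\<lambda>(x, X). X(n := x)) \<in> measurable (N \<Otimes>\<^sub>M vector_law n) (vector_law (Suc n))"
    unfolding std_normal_vector_def lessThan_Suc by measurable
  have "normal_moments (N \<Otimes>\<^sub>M vector_law n) (\<lambda>(z, x). inner (a n) z + (\<Sum>k<n. inner (a k) (x k)))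
     ((norm (a n))\<^sup>2 / DIM('a) + (\<Sum>k<n. (norm (a k))\<^sup>2 / DIM('a)))"
    by (rule normal_moments_add[OF prob_space_axioms prob_space_vector_law normal_moments_inner Suc.IH])
  moreover have "(\<lambda>p. inner (a n) ((case p of (x, X) \<Rightarrow> X(n := x)) n) + (\<Sum>k<n. inner (a k) ((case p of (x, X) \<Rightarrow> X(n := x)) k)))
      = (\<lambda>(z, x). inner (a n) z + (\<Sum>k<n. inner (a k) (x k)))"
    by (auto simp: fun_eq_iff)
  ultimately have "normal_moments (distr (N \<Otimes>\<^sub>M vector_law n) (vector_law (Suc n)) (\<lambda>(x, X). X(n := x)))
     (\<lambda>x. inner (a n) (x n) + (\<Sum>k<n. inner (a k) (x k)))
     ((norm (a n))\<^sup>2 / DIM('a) + (\<Sum>k<n. (norm (a k))\<^sup>2 / DIM('a)))"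
    by (subst normal_moments_distr[OF f m]) simp
  then show ?case unfolding S_Suc[symmetric] by (simp add: add.commute)
qed

abbreviation query_law :: "nat \<Rightarrow> ((nat \<Rightarrow> 'a) \<times> (nat \<Rightarrow> 'a)) measure" where
  "query_law n \<equiv> vector_law n \<Otimes>\<^sub>M vector_law n"

lemma prob_space_query_law: "prob_space (query_law n)"
  by (intro prob_space_pair prob_space_vector_law)

lemma measurable_array_form [measurable]:
  "(\<lambda>w. array_form n A (fst w) (snd w)) \<in> borel_measurable (query_law n)"
  unfolding array_form_def by measurable

text \<open>For fixed \<open>x\<close> the form is linear in \<open>y\<close> with variance |A x|^2
  / \<open>DIM('a)\<close>, so the moments are computed first over \<open>y\<close> and then over
  \<open>x\<close>. The 9 is 3 * 3, one factor from either integration. Nonnegative integrals let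
  Tonelli apply before integrability is known.\<close>

lemma
  fixes u :: 'a
  assumes u: "norm u = 1"
  shows nn_integral_inner_array_form_2:
      "(\<integral>\<^sup>+w. ennreal ((inner u (array_form n A (fst w) (snd w)))\<^sup>2) \<partial>query_law n) = ennreal (array_sqnorm n A / DIM('a))"
    and nn_integral_inner_array_form_4:
      "(\<integral>\<^sup>+w. ennreal (inner u (array_form n A (fst w) (snd w)) ^ 4) \<partial>query_law n) \<le> ennreal (9 * (array_sqnorm n A)\<^sup>2)"
proof -
  interpret S: prob_space "vector_law n" by (rule prob_space_vector_law)
  define Q where "Q x = (\<Sum>k<n. (norm (\<Sum>l<n. A (k, l) * x l))\<^sup>2)" for x
  define X where "X j x = (\<Sum>l<n. inner (conjugate (A (fst j, l)) * snd j) (x l))" for j x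
  \<comment> \<open>One index for each real coordinate of each entry of A x. Summing over the basis
    cancels the factor 1 / \<open>DIM('a)\<close> of the variances, see \<open>sJ\<close>.\<close>
  define J where "J = {..<n} \<times> (Basis :: 'a set)"
  have Q: "Q x = (\<Sum>j\<in>J. (X j x)\<^sup>2)" for x
    unfolding Q_def X_def J_def norm_square_linear_combination by (simp add: sum.cartesian_product split_beta')
  have X: "normal_moments (vector_law n) (X j) (\<Sum>l<n. (norm (A (fst j, l)))\<^sup>2 / DIM('a))" if "j \<in> J" for j
    using normal_moments_linear_form[of n "\<lambda>l. conjugate (A (fst j, l)) * snd j"] that
    unfolding X_def J_def by (auto simp: norm_mult)
  have sJ: "(\<Sum>j\<in>J. \<Sum>l<n. (norm (A (fst j, l)))\<^sup>2 / DIM('a)) = array_sqnorm n A"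
  proof -
    define r where "r k = (\<Sum>l<n. (norm (A (k, l)))\<^sup>2 / DIM('a))" for k
    have "(\<Sum>j\<in>J. r (fst j)) = (\<Sum>k<n. \<Sum>w\<in>(Basis :: 'a set). r k)"
      unfolding J_def by (simp add: sum.cartesian_product split_beta' del: sum_constant)
    also have "\<dots> = array_sqnorm n A"
      by (simp add: array_sqnorm_def r_def sum_divide_distrib[symmetric])
    finally show ?thesis unfolding r_def .
  qed
  have finJ: "finite J" by (simp add: J_def)
  have Xm [measurable]: "X j \<in> borel_measurable (vector_law n)" for j
    unfolding X_def by measurable
  have y: "normal_moments (vector_law n) (\<lambda>y. inner u (array_form n A x y)) (Q x / DIM('a))" for x
  proof -
    have "inner u (array_form n A x y) = (\<Sum>k<n. inner (conjugate (\<Sum>l<n. A (k, l) * x l) * u) (y k))" for y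
      unfolding array_form_def by (simp add: inner_sum_right inner_mult_conjugate)
    then show ?thesis
      using normal_moments_linear_form[of n "\<lambda>k. conjugate (\<Sum>l<n. A (k, l) * x l) * u"] u
      by (simp add: norm_mult Q_def sum_divide_distrib)
  qed
  have "(\<integral>\<^sup>+w. ennreal ((inner u (array_form n A (fst w) (snd w)))\<^sup>2) \<partial>query_law n)
    = (\<integral>\<^sup>+x. \<integral>\<^sup>+y. ennreal ((inner u (array_form n A x y))\<^sup>2) \<partial>vector_law n \<partial>vector_law n)"
    by (subst S.nn_integral_fst[symmetric]) auto
  also have "\<dots> = (\<integral>\<^sup>+x. ennreal (Q x / DIM('a)) \<partial>vector_law n)"
    using normal_moments_nn_integral(1)[OF prob_space_vector_law y] by simp
  also have "\<dots> = (\<integral>\<^sup>+x. (\<Sum>j\<in>J. ennreal (1 / DIM('a)) * ennreal ((X j x)\<^sup>2)) \<partial>vector_law n)"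
    unfolding Q by (simp add: sum_divide_distrib ennreal_mult[symmetric])
  also have "\<dots> = (\<Sum>j\<in>J. ennreal (1 / DIM('a)) * (\<integral>\<^sup>+x. ennreal ((X j x)\<^sup>2) \<partial>vector_law n))"
    by (simp add: nn_integral_sum nn_integral_cmult)
  also have "\<dots> = (\<Sum>j\<in>J. ennreal (1 / DIM('a) * (\<Sum>l<n. (norm (A (fst j, l)))\<^sup>2 / DIM('a))))"
    using normal_moments_nn_integral(1)[OF prob_space_vector_law X]
    by (intro sum.cong refl) (simp add: ennreal_mult[symmetric] sum_nonneg)
  also have "\<dots> = ennreal (1 / DIM('a) * array_sqnorm n A)"
    unfolding sJ[symmetric] sum_distrib_left[symmetric] by (simp add: sum_nonneg sum_divide_distrib)
  finally show "(\<integral>\<^sup>+w. ennreal ((inner u (array_form n A (fst w) (snd w)))\<^sup>2) \<partial>query_law n) = ennreal (array_sqnorm n A / DIM('a))"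
    by simp
  have "(\<integral>\<^sup>+w. ennreal ((inner u (array_form n A (fst w) (snd w)))^4) \<partial>query_law n)
    = (\<integral>\<^sup>+x. \<integral>\<^sup>+y. ennreal ((inner u (array_form n A x y))^4) \<partial>vector_law n \<partial>vector_law n)"
    by (subst S.nn_integral_fst[symmetric]) auto
  also have "\<dots> \<le> (\<integral>\<^sup>+x. ennreal (3 * (Q x / DIM('a))\<^sup>2) \<partial>vector_law n)"
    by (intro nn_integral_mono normal_moments_nn_integral(2)[OF prob_space_vector_law y])
  also have "\<dots> \<le> (\<integral>\<^sup>+x. ennreal (3 * (Q x)\<^sup>2) \<partial>vector_law n)"
  proof (intro nn_integral_mono ennreal_leI mult_left_mono power_mono)
    fix x
    have "DIM('a) \<ge> 1" by (simp add: Suc_leI)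
    then have "real DIM('a) \<ge> 1" by linarith
    moreover have "Q x \<ge> 0" by (simp add: Q_def sum_nonneg)
    ultimately have "Q x * 1 \<le> Q x * DIM('a)" by (intro mult_left_mono) auto
    then show "Q x / DIM('a) \<le> Q x" by (simp add: divide_le_eq)
  qed (auto simp: Q_def sum_nonneg)
  also have "\<dots> = ennreal (\<integral>x. 3 * (Q x)\<^sup>2 \<partial>vector_law n)"
    using normal_moments_sum_squares(1)[OF prob_space_vector_law finJ X] unfolding Q
    by (intro nn_integral_eq_integral) auto
  also have "\<dots> \<le> ennreal (9 * (array_sqnorm n A)\<^sup>2)"
    using normal_moments_sum_squares(2)[where X = X, OF prob_space_vector_law[of n] finJ X] unfolding Q sJ
    by (intro ennreal_leI) simp
  finally show "(\<integral>\<^sup>+w. ennreal (inner u (array_form n A (fst w) (snd w)) ^ 4) \<partial>query_law n) \<le> ennreal (9 * (array_sqnorm n A)\<^sup>2)" .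
qed

lemma
  fixes u :: 'a
  assumes u: "norm u = 1"
  shows integrable_inner_array_form_2:
      "integrable (query_law n) (\<lambda>w. (inner u (array_form n A (fst w) (snd w)))\<^sup>2)"
    and integral_inner_array_form_2:
      "(\<integral>w. (inner u (array_form n A (fst w) (snd w)))\<^sup>2 \<partial>query_law n) = array_sqnorm n A / DIM('a)"
    and integrable_inner_array_form_4:
      "integrable (query_law n) (\<lambda>w. inner u (array_form n A (fst w) (snd w)) ^ 4)"
    and integral_inner_array_form_4:
      "(\<integral>w. inner u (array_form n A (fst w) (snd w)) ^ 4 \<partial>query_law n) \<le> 9 * (array_sqnorm n A)\<^sup>2"
proof -
  have "integrable (query_law n) (\<lambda>w. (inner u (array_form n A (fst w) (snd w)))\<^sup>2) \<and>
    (\<integral>w. (inner u (array_form n A (fst w) (snd w)))\<^sup>2 \<partial>query_law n) = array_sqnorm n A / DIM('a)"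
  proof (rule nn_integral_eq_integrable[THEN iffD1])
    show "(\<lambda>w. (inner u (array_form n A (fst w) (snd w)))\<^sup>2) \<in> borel_measurable (query_law n)" by measurable
  qed (use nn_integral_inner_array_form_2[OF u, of n A] array_sqnorm_nonneg[of n A] in auto)
  then show "integrable (query_law n) (\<lambda>w. (inner u (array_form n A (fst w) (snd w)))\<^sup>2)"
    "(\<integral>w. (inner u (array_form n A (fst w) (snd w)))\<^sup>2 \<partial>query_law n) = array_sqnorm n A / DIM('a)"
    by blast+
  show *: "integrable (query_law n) (\<lambda>w. inner u (array_form n A (fst w) (snd w)) ^ 4)"
  proof (rule integrableI_nonneg)
    show "(\<lambda>w. inner u (array_form n A (fst w) (snd w)) ^ 4) \<in> borel_measurable (query_law n)" by measurable
    show "(\<integral>\<^sup>+w. ennreal (inner u (array_form n A (fst w) (snd w)) ^ 4) \<partial>query_law n) < \<infinity>"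
      using nn_integral_inner_array_form_4[OF u, of n A] by (rule le_less_trans) simp
  qed simp
  show "(\<integral>w. inner u (array_form n A (fst w) (snd w)) ^ 4 \<partial>query_law n) \<le> 9 * (array_sqnorm n A)\<^sup>2"
    using nn_integral_inner_array_form_4[OF u, of n A]
    by (subst (asm) nn_integral_eq_integral[OF *]) auto
qed

lemma
  shows integrable_norm_array_form: "integrable (query_law n) (\<lambda>w. (norm (array_form n A (fst w) (snd w)))\<^sup>2)"
    and integral_norm_array_form: "(\<integral>w. (norm (array_form n A (fst w) (snd w)))\<^sup>2 \<partial>query_law n) = array_sqnorm n A"
proof -
  have eq: "(norm (array_form n A (fst w) (snd w)))\<^sup>2 = (\<Sum>u\<in>Basis. (inner u (array_form n A (fst w) (snd w)))\<^sup>2)" for w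
    by (subst power2_norm_eq_inner, subst euclidean_inner) (simp add: power2_eq_square inner_commute)
  show "integrable (query_law n) (\<lambda>w. (norm (array_form n A (fst w) (snd w)))\<^sup>2)"
    unfolding eq by (intro Bochner_Integration.integrable_sum integrable_inner_array_form_2) simp
  show "(\<integral>w. (norm (array_form n A (fst w) (snd w)))\<^sup>2 \<partial>query_law n) = array_sqnorm n A"
    unfolding eq by (subst Bochner_Integration.integral_sum)
      (simp_all add: integrable_inner_array_form_2 integral_inner_array_form_2)
qed

end

section \<open>The real and the complex standard normal scalar\<close>

lemma normal_moments_std_normal: "normal_moments std_normal_distribution (inner a) ((norm a)\<^sup>2)" for a :: real
proof -
  have m: "has_bochner_integral lborel (\<lambda>x. std_normal_density x * x) 0"
    "has_bochner_integral lborel (\<lambda>x. std_normal_density x * x\<^sup>2) 1"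
    "has_bochner_integral lborel (\<lambda>x. std_normal_density x * x^4) 3"
    using std_normal_moment_odd[of 0] std_normal_moment_even[of 1] std_normal_moment_even[of 2]
    by (simp_all add: fact_numeral)
  have d: "has_bochner_integral std_normal_distribution g c"
    if "has_bochner_integral lborel (\<lambda>x. std_normal_density x * g x) c" "g \<in> borel_measurable borel"
    for g :: "real \<Rightarrow> real" and c
    using that by (intro has_bochner_integral_density) auto
  have e: "has_bochner_integral std_normal_distribution (\<lambda>x. inner a x ^ 1) 0"
    "has_bochner_integral std_normal_distribution (\<lambda>x. inner a x ^ 2) (a\<^sup>2)"
    "has_bochner_integral std_normal_distribution (\<lambda>x. inner a x ^ 4) (a^4 * 3)"
    using has_bochner_integral_mult_right[OF d[OF m(1)], of a] has_bochner_integral_mult_right[OF d[OF m(2)], of "a\<^sup>2"]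
      has_bochner_integral_mult_right[OF d[OF m(3)], of "a^4"]
    by (simp_all add: power_mult_distrib)
  have "(norm a)\<^sup>2 = a\<^sup>2" "((norm a)\<^sup>2)\<^sup>2 = a^4" by (simp_all flip: power_mult)
  moreover have "inner a \<in> borel_measurable std_normal_distribution" by simp
  ultimately show ?thesis
    using e unfolding normal_moments_def has_bochner_integral_iff by simp
qed

lemma normal_scalar_real: "normal_scalar (std_normal_distribution :: real measure)"
proof (intro normal_scalar.intro normal_scalar_axioms.intro)
  show "prob_space std_normal_distribution" by (rule prob_space_normal_density) simp
  show "sets std_normal_distribution = sets borel" by simp
  show "normal_moments std_normal_distribution (inner a) ((norm a)\<^sup>2 / DIM(real))" for a
    using normal_moments_std_normal[of a] by simp
qed

lemma normal_scalar_complex: "normal_scalar complex_std_normal"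
proof -
  let ?N = "std_normal_distribution :: real measure"
  let ?f = "\<lambda>(z1, z2). (complex_of_real z1 + \<i> * complex_of_real z2) / complex_of_real (sqrt 2)"
  interpret P: prob_space "?N \<Otimes>\<^sub>M ?N"
    by (intro prob_space_pair prob_space_normal_density) simp_all
  have f: "?f \<in> measurable (?N \<Otimes>\<^sub>M ?N) borel"
    unfolding split_beta' by (intro borel_measurable_divide borel_measurable_add borel_measurable_times borel_measurable_const measurable_compose[OF measurable_fst] measurable_compose[OF measurable_snd]) simp_all
  show ?thesis
  proof (intro normal_scalar.intro normal_scalar_axioms.intro)
    show "prob_space complex_std_normal"
      unfolding complex_std_normal_def by (rule P.prob_space_distr[OF f])
    show "sets complex_std_normal = sets borel" by (simp add: complex_std_normal_def)
    fix a
    \<comment> \<open>The inner product with \<open>a\<close> is a sum of two independent real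
      normals with variances (Re a)^2 / 2 and (Im a)^2 / 2.\<close>
    have "normal_moments (?N \<Otimes>\<^sub>M ?N) (\<lambda>(x, y). inner (Re a / sqrt 2) x + inner (Im a / sqrt 2) y)
        ((norm (Re a / sqrt 2))\<^sup>2 + (norm (Im a / sqrt 2))\<^sup>2)"
      by (intro normal_moments_add normal_moments_std_normal prob_space_normal_density) simp_all
    also have "(\<lambda>(x, y). inner (Re a / sqrt 2) x + inner (Im a / sqrt 2) y) = (\<lambda>p. inner a (?f p))"
      by (simp add: fun_eq_iff inner_complex_def Re_divide_of_real Im_divide_of_real split: prod.split)
    also have "(norm (Re a / sqrt 2))\<^sup>2 + (norm (Im a / sqrt 2))\<^sup>2 = (norm a)\<^sup>2 / DIM(complex)"
      by (simp add: power_divide cmod_power2 add_divide_distrib)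
    finally show "normal_moments complex_std_normal (inner a) ((norm a)\<^sup>2 / DIM(complex))"
      unfolding complex_std_normal_def by (subst normal_moments_distr[OF f]) simp_all
  qed
qed

section \<open>Lower bound for random bilinear queries\<close>

text \<open>\<open>query_space\<close> draws all the x's and then all the y's, whereas the empirical
  process needs iid samples, namely the pairs (x_i, y_i). This lemma regroups the coordinates,
  peeling off one index from both products at a time.\<close>

lemma nn_integral_pair_PiM:
  assumes A: "prob_space A" and B: "prob_space B" and I: "finite I"
    and f: "f \<in> borel_measurable ((\<Pi>\<^sub>M i\<in>I. A) \<Otimes>\<^sub>M (\<Pi>\<^sub>M i\<in>I. B))"
  shows "(\<integral>\<^sup>+w. f w \<partial>((\<Pi>\<^sub>M i\<in>I. A) \<Otimes>\<^sub>M (\<Pi>\<^sub>M i\<in>I. B)))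
    = (\<integral>\<^sup>+z. f (\<lambda>i\<in>I. fst (z i), \<lambda>i\<in>I. snd (z i)) \<partial>(\<Pi>\<^sub>M i\<in>I. A \<Otimes>\<^sub>M B))"
  using I f
proof (induction I arbitrary: f)
  case empty
  have "(\<integral>\<^sup>+w. f w \<partial>((\<Pi>\<^sub>M i\<in>{}. A) \<Otimes>\<^sub>M (\<Pi>\<^sub>M i\<in>{}. B)))
    = (\<integral>\<^sup>+x. \<integral>\<^sup>+y. f (x, y) \<partial>(\<Pi>\<^sub>M i\<in>{}. B) \<partial>(\<Pi>\<^sub>M i\<in>{}. A))"
    using prob_space_imp_sigma_finite[OF prob_space_PiM[of "{}" "\<lambda>_. B"]] empty
    by (subst sigma_finite_measure.nn_integral_fst) auto
  then show ?case
    by (simp add: PiM_empty nn_integral_count_space_finite restrict_def)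
next
  case (insert i I)
  let ?A = "\<lambda>I. \<Pi>\<^sub>M i\<in>I. A" and ?B = "\<lambda>I. \<Pi>\<^sub>M i\<in>I. B" and ?C = "\<lambda>I. \<Pi>\<^sub>M i\<in>I. A \<Otimes>\<^sub>M B"
  note [measurable] = insert.prems
  have C: "prob_space (A \<Otimes>\<^sub>M B)" by (intro prob_space_pair A B)
  interpret A: prob_space A by fact
  interpret B: prob_space B by fact
  interpret PA: product_sigma_finite "\<lambda>_. A"
    by (simp add: product_sigma_finite_def prob_space_imp_sigma_finite A)
  interpret PB: product_sigma_finite "\<lambda>_. B"
    by (simp add: product_sigma_finite_def prob_space_imp_sigma_finite B)
  interpret PC: product_sigma_finite "\<lambda>_. A \<Otimes>\<^sub>M B"
    by (simp add: product_sigma_finite_def prob_space_imp_sigma_finite C)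
  interpret BI: prob_space "?B I" by (intro prob_space_PiM B)
  interpret BI': prob_space "?B (insert i I)" by (intro prob_space_PiM B)
  interpret ABI: pair_sigma_finite A "?B I" ..
  define G where "G w = (\<integral>\<^sup>+u. f ((fst w)(i := fst u), (snd w)(i := snd u)) \<partial>(A \<Otimes>\<^sub>M B))" for w
  have G [measurable]: "G \<in> borel_measurable (?A I \<Otimes>\<^sub>M ?B I)"
    unfolding G_def by measurable
  have "(\<integral>\<^sup>+w. f w \<partial>(?A (insert i I) \<Otimes>\<^sub>M ?B (insert i I)))
    = (\<integral>\<^sup>+x. \<integral>\<^sup>+y. f (x, y) \<partial>?B (insert i I) \<partial>?A (insert i I))"
    by (rule BI'.nn_integral_fst[symmetric]) measurable
  also have "\<dots> = (\<integral>\<^sup>+x. \<integral>\<^sup>+s. \<integral>\<^sup>+y. f (x(i := s), y) \<partial>?B (insert i I) \<partial>A \<partial>?A I)"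
    by (rule PA.product_nn_integral_insert) (use insert in measurable)
  also have "\<dots> = (\<integral>\<^sup>+x. \<integral>\<^sup>+s. \<integral>\<^sup>+y. \<integral>\<^sup>+t. f (x(i := s), y(i := t)) \<partial>B \<partial>?B I \<partial>A \<partial>?A I)"
  proof (intro nn_integral_cong)
    fix x s assume [measurable]: "x \<in> space (?A I)" "s \<in> space A"
    have "x(i := s) \<in> space (?A (insert i I))"
      using \<open>x \<in> space (?A I)\<close> \<open>s \<in> space A\<close> by (auto simp: space_PiM PiE_iff extensional_def)
    then show "(\<integral>\<^sup>+y. f (x(i := s), y) \<partial>?B (insert i I)) = (\<integral>\<^sup>+y. \<integral>\<^sup>+t. f (x(i := s), y(i := t)) \<partial>B \<partial>?B I)"
      by (intro PB.product_nn_integral_insert) (use insert in auto)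
  qed
  \<comment> \<open>Tonelli moves the new coordinate \<open>s\<close> past the old coordinates
    \<open>y\<close>, so that \<open>s\<close> and \<open>t\<close> become adjacent and form a
    pair.\<close>
  also have "\<dots> = (\<integral>\<^sup>+x. \<integral>\<^sup>+y. \<integral>\<^sup>+s. \<integral>\<^sup>+t. f (x(i := s), y(i := t)) \<partial>B \<partial>A \<partial>?B I \<partial>?A I)"
    by (intro nn_integral_cong ABI.Fubini'[symmetric]) measurable
  also have "\<dots> = (\<integral>\<^sup>+x. \<integral>\<^sup>+y. G (x, y) \<partial>?B I \<partial>?A I)"
    unfolding G_def by (intro nn_integral_cong, subst B.nn_integral_fst[symmetric]) measurable
  also have "\<dots> = (\<integral>\<^sup>+w. G w \<partial>(?A I \<Otimes>\<^sub>M ?B I))"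
    by (rule BI.nn_integral_fst) measurable
  also have "\<dots> = (\<integral>\<^sup>+z. G (\<lambda>i\<in>I. fst (z i), \<lambda>i\<in>I. snd (z i)) \<partial>?C I)"
    by (rule insert.IH[OF G])
  also have "\<dots> = (\<integral>\<^sup>+z. \<integral>\<^sup>+u. f (\<lambda>j\<in>insert i I. fst ((z(i := u)) j), \<lambda>j\<in>insert i I. snd ((z(i := u)) j)) \<partial>(A \<Otimes>\<^sub>M B) \<partial>?C I)"
  proof -
    have e: "(\<lambda>i\<in>I. fst (z i))(i := fst u) = (\<lambda>j\<in>insert i I. fst ((z(i := u)) j))"
      "(\<lambda>i\<in>I. snd (z i))(i := snd u) = (\<lambda>j\<in>insert i I. snd ((z(i := u)) j))" for z u
      using insert.hyps by (auto simp: fun_eq_iff)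
    show ?thesis by (simp only: G_def fst_conv snd_conv e)
  qed
  also have "\<dots> = (\<integral>\<^sup>+z. f (\<lambda>i\<in>insert i I. fst (z i), \<lambda>i\<in>insert i I. snd (z i)) \<partial>?C (insert i I))"
    by (rule PC.product_nn_integral_insert[symmetric]) (use insert in measurable)
  finally show ?case .
qed

lemma distr_PiM_pair:
  assumes "prob_space A" "prob_space B" "finite I"
  shows "(\<Pi>\<^sub>M i\<in>I. A) \<Otimes>\<^sub>M (\<Pi>\<^sub>M i\<in>I. B)
    = distr (\<Pi>\<^sub>M i\<in>I. A \<Otimes>\<^sub>M B) ((\<Pi>\<^sub>M i\<in>I. A) \<Otimes>\<^sub>M (\<Pi>\<^sub>M i\<in>I. B)) (\<lambda>z. (\<lambda>i\<in>I. fst (z i), \<lambda>i\<in>I. snd (z i)))"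
    (is "?Q = distr ?P ?Q ?h")
proof (rule measure_eqI)
  have h [measurable]: "?h \<in> measurable ?P ?Q" by measurable
  fix X assume X [measurable]: "X \<in> sets ?Q"
  have "emeasure ?Q X = (\<integral>\<^sup>+w. indicator X w \<partial>?Q)" by simp
  also have "\<dots> = (\<integral>\<^sup>+z. indicator X (?h z) \<partial>?P)"
    by (rule nn_integral_pair_PiM[OF assms]) simp
  also have "\<dots> = (\<integral>\<^sup>+w. indicator X w \<partial>distr ?P ?Q ?h)"
    by (rule nn_integral_distr[OF h, symmetric]) simp
  also have "\<dots> = emeasure (distr ?P ?Q ?h) X" by simp
  finally show "emeasure ?Q X = emeasure (distr ?P ?Q ?h) X" .
qed simp

lemma (in prob_space)
  fixes g :: "'a \<Rightarrow> real"
  assumes g: "integrable M g" and i: "i \<in> I"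
  shows integrable_PiM_component: "integrable (\<Pi>\<^sub>M i\<in>I. M) (\<lambda>z. g (z i))"
    and integral_PiM_component: "(\<integral>z. g (z i) \<partial>(\<Pi>\<^sub>M i\<in>I. M)) = expectation g"
proof -
  have d: "distr (\<Pi>\<^sub>M i\<in>I. M) M (\<lambda>z. z i) = M"
    using i prob_space_axioms by (intro distr_PiM_component)
  have m: "(\<lambda>z. z i) \<in> measurable (\<Pi>\<^sub>M i\<in>I. M) M" using i by simp
  have "g \<in> borel_measurable M" using g by simp
  then show "integrable (\<Pi>\<^sub>M i\<in>I. M) (\<lambda>z. g (z i))" "(\<integral>z. g (z i) \<partial>(\<Pi>\<^sub>M i\<in>I. M)) = expectation g"
    using integrable_distr_eq[OF m, of g] integral_distr[OF m, of g] g unfolding d by simp_all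
qed

text \<open>Every coordinate of a unit vector is rounded to a finite \<open>\<delta> / 2\<close>-net
  of the unit ball of the scalars, which leaves finitely many rounded vectors. A rounded vector may
  leave the sphere. Therefore one unit vector is chosen for each rounding that occurs, and two unit
  vectors with the same rounding differ by at most \<open>\<delta>\<close> in each
  coordinate.\<close>

lemma finite_net_of_unit_sphere:
  fixes d :: nat and \<delta> :: real
  assumes "\<delta> > 0"
  obtains T :: "(nat \<Rightarrow> 'e::euclidean_space) set" where "finite T"
    "\<And>c. c \<in> T \<Longrightarrow> (\<Sum>j<d. (norm (c j))\<^sup>2) = 1"
    "\<And>c. (\<Sum>j<d. (norm (c j))\<^sup>2) = 1 \<Longrightarrow> \<exists>c'\<in>T. \<forall>j<d. norm (c j - c' j) \<le> \<delta>"
proof -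
  obtain K :: "'e set" where K: "finite K" "cball 0 1 \<subseteq> (\<Union>x\<in>K. ball x (\<delta> / 2))"
    using compact_cball[of "0 :: 'e" 1] assms unfolding compact_eq_totally_bounded
    by (metis half_gt_zero)
  have "\<exists>x. x \<in> K \<and> dist x z < \<delta> / 2" if "norm z \<le> 1" for z
  proof -
    have "z \<in> cball 0 1" using that by simp
    then have "z \<in> (\<Union>x\<in>K. ball x (\<delta> / 2))" using K(2) by blast
    then show ?thesis by auto
  qed
  then obtain g where g: "\<And>z. norm z \<le> 1 \<Longrightarrow> g z \<in> K \<and> dist (g z) z < \<delta> / 2" by metis
  define U where "U = {c :: nat \<Rightarrow> 'e. (\<Sum>j<d. (norm (c j))\<^sup>2) = 1}"
  define F where "F c = (\<lambda>j\<in>{..<d}. g (c j))" for c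
  have norm1: "norm (c j) \<le> 1" if "c \<in> U" "j < d" for c j
  proof -
    have "(norm (c j))\<^sup>2 \<le> (\<Sum>j<d. (norm (c j))\<^sup>2)"
      using that by (intro member_le_sum) auto
    also have "\<dots> = 1\<^sup>2" using that by (simp add: U_def)
    finally show ?thesis by (rule power2_le_imp_le) simp
  qed
  have "F ` U \<subseteq> {..<d} \<rightarrow>\<^sub>E K"
  proof (rule image_subsetI)
    fix c assume c: "c \<in> U"
    show "F c \<in> {..<d} \<rightarrow>\<^sub>E K"
      using g norm1[OF c] by (simp add: F_def PiE_iff)
  qed
  then have fin: "finite (F ` U)"
    using finite_PiE[of "{..<d}" "\<lambda>_. K"] K(1) finite_subset by blast
  show ?thesis
  proof
    show "finite (inv_into U F ` F ` U)" using fin by simp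
    show "(\<Sum>j<d. (norm (c j))\<^sup>2) = 1" if "c \<in> inv_into U F ` F ` U" for c
      using that inv_into_into[of _ F U] unfolding U_def by auto
    show "\<exists>c'\<in>inv_into U F ` F ` U. \<forall>j<d. norm (c j - c' j) \<le> \<delta>" if "(\<Sum>j<d. (norm (c j))\<^sup>2) = 1" for c
    proof
      have c: "c \<in> U" using that by (simp add: U_def)
      let ?c' = "inv_into U F (F c)"
      show "?c' \<in> inv_into U F ` F ` U" using c by blast
      have c': "?c' \<in> U" "F ?c' = F c" using c f_inv_into_f[of "F c" F U] by (auto intro: inv_into_into)
      show "\<forall>j<d. norm (c j - ?c' j) \<le> \<delta>"
      proof safe
        fix j assume j: "j < d"
        have "g (?c' j) = g (c j)" using fun_cong[OF c'(2), of j] j by (simp add: F_def)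
        then have "dist (c j) (?c' j) < \<delta>"
          using g[OF norm1[OF c j]] g[OF norm1[OF c'(1) j]] dist_triangle_half_r[of "g (c j)" "c j" \<delta> "?c' j"] by simp
        then show "norm (c j - ?c' j) \<le> \<delta>" by (simp add: dist_norm)
      qed
    qed
  qed
qed

text \<open>The polynomial on the left has its maximum at x^2 = 18, where it equals the cap 3. Below
  the cap, x^2 / 3 is at most \<bar>x\<bar>. It makes the truncated mean computable from the second
  and fourth moments.\<close>

lemma min_abs_three_ge: "x\<^sup>2 / 3 - x ^ 4 / 108 \<le> min \<bar>x\<bar> 3" for x :: real
proof -
  have "0 \<le> (x\<^sup>2 - 18)\<^sup>2 / 108" by simp
  also have "\<dots> = 3 - (x\<^sup>2 / 3 - x ^ 4 / 108)"
    by (simp add: power2_eq_square power4_eq_xxxx field_simps)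
  finally have 1: "x\<^sup>2 / 3 - x ^ 4 / 108 \<le> 3" by simp
  have "x\<^sup>2 / 3 - x ^ 4 / 108 \<le> \<bar>x\<bar>" if "\<bar>x\<bar> < 3"
  proof -
    have "x\<^sup>2 \<le> 3 * \<bar>x\<bar>"
      using mult_right_mono[of "\<bar>x\<bar>" 3 "\<bar>x\<bar>"] that by (simp add: power2_eq_square abs_mult_self_eq)
    moreover have "x ^ 4 \<ge> 0" by simp
    ultimately show ?thesis by linarith
  qed
  then show ?thesis using 1 by linarith
qed

text \<open>A quantitative substitute for the Paley-Zygmund inequality: the value is (1/2) / 3 - 9 /
  108 = 1/12. The assumed moments are those of the real part of an answer for a unit matrix.\<close>

lemma (in prob_space) expectation_min_abs_three_ge:
  fixes X :: "'a \<Rightarrow> real"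
  assumes [measurable]: "X \<in> borel_measurable M"
    and "integrable M (\<lambda>x. (X x)\<^sup>2)" "integrable M (\<lambda>x. X x ^ 4)"
    and "expectation (\<lambda>x. (X x)\<^sup>2) \<ge> 1 / 2" "expectation (\<lambda>x. X x ^ 4) \<le> 9"
  shows "expectation (\<lambda>x. min \<bar>X x\<bar> 3) \<ge> 1 / 12"
proof -
  have "1 / 12 \<le> expectation (\<lambda>x. (X x)\<^sup>2) / 3 - expectation (\<lambda>x. X x ^ 4) / 108"
    using assms by simp
  also have "\<dots> = expectation (\<lambda>x. (X x)\<^sup>2 / 3 - X x ^ 4 / 108)"
    using assms by simp
  also have "\<dots> \<le> expectation (\<lambda>x. min \<bar>X x\<bar> 3)"
  proof (intro integral_mono min_abs_three_ge)
    show "integrable M (\<lambda>x. min \<bar>X x\<bar> 3)"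
      by (intro integrable_const_bound[of _ 3]) auto
  qed (use assms in simp)
  finally show ?thesis .
qed

lemma array_form_lincomb:
  "array_form n (\<lambda>ab. \<Sum>j<d. c j * E j ab) x y = (\<Sum>j<d. c j * array_form n (E j) x y)"
proof -
  have "array_form n (\<lambda>ab. \<Sum>j<d. c j * E j ab) x y = (\<Sum>k<n. \<Sum>l<n. \<Sum>j<d. c j * (y k * (E j (k, l) * x l)))"
    unfolding array_form_def by (simp add: sum_distrib_left sum_distrib_right mult_ac)
  also have "\<dots> = (\<Sum>k<n. \<Sum>j<d. \<Sum>l<n. c j * (y k * (E j (k, l) * x l)))"
    by (intro sum.cong refl sum.swap)
  also have "\<dots> = (\<Sum>j<d. \<Sum>k<n. \<Sum>l<n. c j * (y k * (E j (k, l) * x l)))"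
    by (rule sum.swap)
  also have "\<dots> = (\<Sum>j<d. c j * array_form n (E j) x y)"
    unfolding array_form_def by (simp add: sum_distrib_left mult_ac)
  finally show ?thesis .
qed

lemma array_form_eq_0:
  assumes "array_sqnorm n R = 0"
  shows "array_form n R x y = 0"
proof -
  have "\<forall>k<n. \<forall>l<n. R (k, l) = 0"
    using assms unfolding array_sqnorm_def by (simp add: sum_nonneg_eq_0_iff sum_nonneg)
  then show ?thesis unfolding array_form_def by simp
qed

section \<open>The lower bound and the noise bound on one event of probability 9/10\<close>

context normal_scalar
begin

text \<open>With \<open>p = 1440\<^sup>2 d\<close> queries and the potential parameter \<open>s = 2880 d\<close>, each of the three terms
of \<open>Z\<close> below has expectation at most \<open>1 / 30\<close>. The mesh \<open>\<delta>\<close> is chosen after the bound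
on the sum of the \<open>\<bar>v\<bar>\<^sup>2\<close>; the size of the net is irrelevant, as the bound on the expected
maximum does not depend on it.\<close>

lemma random_queries_bounds:
  fixes E :: "nat \<Rightarrow> nat \<times> nat \<Rightarrow> 'a" and R :: "nat \<times> nat \<Rightarrow> 'a" and n d :: nat
  defines "p \<equiv> 2073600 * d"
  assumes d: "d > 0"
    and E: "\<And>c. array_sqnorm n (\<lambda>ab. \<Sum>j<d. c j * E j ab) = (\<Sum>j<d. (norm (c j))\<^sup>2)"
  obtains G where "G \<in> sets (\<Pi>\<^sub>M i\<in>{..<p}. query_law n)" "measure (\<Pi>\<^sub>M i\<in>{..<p}. query_law n) G \<ge> 9 / 10"
    "\<And>z c. z \<in> G \<Longrightarrow> real p * (\<Sum>j<d. (norm (c j))\<^sup>2)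
       \<le> 2304 * (\<Sum>i<p. (norm (array_form n (\<lambda>ab. \<Sum>j<d. c j * E j ab) (fst (z i)) (snd (z i))))\<^sup>2)"
    "\<And>z. z \<in> G \<Longrightarrow> (\<Sum>i<p. (norm (array_form n R (fst (z i)) (snd (z i))))\<^sup>2) \<le> 30 * real p * array_sqnorm n R"
proof -
  interpret W: prob_space "query_law n" by (rule prob_space_query_law)
  let ?P = "\<Pi>\<^sub>M i\<in>{..<p}. query_law n"
  interpret P: prob_space ?P by (intro prob_space_PiM prob_space_query_law)
  define v where "v w j = array_form n (E j) (fst w) (snd w)" for w j
  define t where "t c w = (\<Sum>j<d. inner (c j) (v w j))" for c w
  \<comment> \<open>The sign is negative because the maximal inequality controls upward deviations,
    whereas small values of the truncated answers are to be excluded.\<close>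
  define f where "f c w = - min \<bar>t c w\<bar> 3" for c w
  define \<mu> where "\<mu> c = W.expectation (f c)" for c
  define \<rho> where "\<rho> = array_sqnorm n R"
  define h where "h w = (norm (array_form n R (fst w) (snd w)))\<^sup>2" for w
  define q where "q w = (\<Sum>j<d. (norm (v w j))\<^sup>2)" for w
  \<comment> \<open>Rounding to the net will cost at most
    \<open>\<delta> * (16 * p * d) = p / 48\<close>, half of the \<open>p / 24\<close> available at
    net points.\<close>
  define \<delta> :: real where "\<delta> = 1 / (768 * real d)"
  have \<delta>: "\<delta> > 0" using d by (simp add: \<delta>_def)
  have p: "p > 0" "real p = 2073600 * real d" using d by (simp_all add: p_def)
  \<comment> \<open>Since \<open>inner c v\<close> is the real part of conj c * v,
    \<open>t c\<close> is the real part of the answer for the combination with conjugated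
    coefficients.\<close>
  have t_eq: "t c w = inner 1 (array_form n (\<lambda>ab. \<Sum>j<d. conjugate (c j) * E j ab) (fst w) (snd w))" for c w
    unfolding t_def v_def array_form_lincomb by (simp add: inner_sum_right inner_mult)
  have sq: "array_sqnorm n (\<lambda>ab. \<Sum>j<d. conjugate (c j) * E j ab) = (\<Sum>j<d. (norm (c j))\<^sup>2)" for c
    using E[of "\<lambda>j. conjugate (c j)"] by simp
  have E1: "array_sqnorm n (E j) = 1" if j: "j < d" for j
  proof -
    have "(\<Sum>i<d. (if i = j then 1 else 0) * E i ab) = E j ab" for ab
      using j by (simp add: if_distrib[of "\<lambda>x. x * _"] sum.delta cong: if_cong)
    then show ?thesis
      using E[of "\<lambda>i. if i = j then 1 else 0"] j
      by (simp add: if_distrib[of norm] if_distrib[of "\<lambda>x. x\<^sup>2"] cong: if_cong)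
  qed
  have v_meas [measurable]: "(\<lambda>w. v w j) \<in> borel_measurable (query_law n)" for j
    unfolding v_def by measurable
  have t_meas [measurable]: "t c \<in> borel_measurable (query_law n)" for c
    unfolding t_def by measurable
  have f_meas [measurable]: "f c \<in> borel_measurable (query_law n)" for c
    unfolding f_def by measurable
  have f_int: "integrable (query_law n) (f c)" for c
    by (intro W.integrable_const_bound[of _ 3]) (auto simp: f_def)
  have v2_int: "integrable (query_law n) (\<lambda>w. (norm (v w j))\<^sup>2)" for j
    unfolding v_def by (rule integrable_norm_array_form)
  have v_int: "integrable (query_law n) (\<lambda>w. v w j)" for j
  proof (rule Bochner_Integration.integrable_bound)
    show "integrable (query_law n) (\<lambda>w. 1 + (norm (v w j))\<^sup>2)" using v2_int by simp
    show "AE w in query_law n. norm (v w j) \<le> norm (1 + (norm (v w j))\<^sup>2)"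
    proof (rule AE_I2)
      fix w
      have "0 \<le> (norm (v w j) - 1)\<^sup>2" by simp
      then have "2 * norm (v w j) \<le> 1 + (norm (v w j))\<^sup>2" by (simp add: power2_diff)
      then show "norm (v w j) \<le> norm (1 + (norm (v w j))\<^sup>2)"
        using norm_ge_zero[of "v w j"] unfolding real_norm_def by linarith
    qed
  qed simp
  have q_eq: "q = (\<lambda>w. \<Sum>j<d. (norm (v w j))\<^sup>2)" by (auto simp: q_def)
  have q_int: "integrable (query_law n) q"
    unfolding q_eq by (intro Bochner_Integration.integrable_sum v2_int)
  have q_exp: "W.expectation q = real d"
    unfolding q_eq using v2_int integral_norm_array_form E1 by (simp add: v_def)
  have h_eq: "h = (\<lambda>w. (norm (array_form n R (fst w) (snd w)))\<^sup>2)" by (auto simp: h_def)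
  have h_int: "integrable (query_law n) h" and h_exp: "W.expectation h = \<rho>"
    unfolding h_eq \<rho>_def by (rule integrable_norm_array_form integral_norm_array_form)+
  obtain T0 :: "(nat \<Rightarrow> 'a) set" where T0: "finite T0" "\<And>c. c \<in> T0 \<Longrightarrow> (\<Sum>j<d. (norm (c j))\<^sup>2) = 1"
    "\<And>c. (\<Sum>j<d. (norm (c j))\<^sup>2) = 1 \<Longrightarrow> \<exists>c'\<in>T0. \<forall>j<d. norm (c j - c' j) \<le> \<delta>"
    using finite_net_of_unit_sphere[OF \<delta>, of d] by metis
  \<comment> \<open>The process vanishes at the zero coefficients. Adding them makes
    \<open>Mx\<close> nonnegative, as Markov's inequality for \<open>Z\<close> requires, and
    \<open>T\<close> nonempty.\<close>
  define T where "T = insert (\<lambda>_. 0) T0"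
  have T: "finite T" "T \<noteq> {}" "\<And>c. c \<in> T \<Longrightarrow> (\<Sum>j<d. (norm (c j))\<^sup>2) \<le> 1"
    using T0 by (auto simp: T_def)
  define Mx where "Mx z = (MAX c\<in>T. (\<Sum>j<d. inner (c j) (0::'a)) + (\<Sum>i<p. f c (z i) - \<mu> c))" for z
  \<comment> \<open>On \<open>Z z < 1\<close> each nonnegative summand is below 1, so a single
    application of Markov's inequality yields all three bounds at once.\<close>
  define Z where "Z z = Mx z * (24 / p) + (\<Sum>i<p. q (z i)) / (30 * p * d) + (\<Sum>i<p. h (z i)) / (30 * p * \<rho>)" for z

  have \<mu>_le: "\<mu> c \<le> - (1 / 12)" if "c \<in> T0" for c
  proof -
    have D: "1 / real DIM('a) \<ge> 1 / 2"
      using Basis_card_le[where 'a = 'a] by (intro divide_left_mono) auto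
    have "W.expectation (\<lambda>w. min \<bar>t c w\<bar> 3) \<ge> 1 / 12"
    proof (rule W.expectation_min_abs_three_ge)
      show "integrable (query_law n) (\<lambda>w. (t c w)\<^sup>2)" "integrable (query_law n) (\<lambda>w. t c w ^ 4)"
        unfolding t_eq by (intro integrable_inner_array_form_2 integrable_inner_array_form_4 norm_one)+
      show "W.expectation (\<lambda>w. (t c w)\<^sup>2) \<ge> 1 / 2"
        unfolding t_eq using integral_inner_array_form_2[OF norm_one] sq[of c] T0(2)[OF that] D by simp
      show "W.expectation (\<lambda>w. t c w ^ 4) \<le> 9"
        unfolding t_eq using integral_inner_array_form_4[OF norm_one, of n "\<lambda>ab. \<Sum>j<d. conjugate (c j) * E j ab"]
          sq[of c] T0(2)[OF that] by simp
    qed measurable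
    then show ?thesis unfolding \<mu>_def f_def by simp
  qed

  have comp_int: "integrable ?P (\<lambda>z. g (z i))" if "integrable (query_law n) g" "i < p" for g :: "_ \<Rightarrow> real" and i
    using W.integrable_PiM_component[OF that(1), of i "{..<p}"] that by simp
  have comp_exp: "P.expectation (\<lambda>z. g (z i)) = W.expectation g" if "integrable (query_law n) g" "i < p" for g :: "_ \<Rightarrow> real" and i
    using W.integral_PiM_component[OF that(1), of i "{..<p}"] that by simp
  have Mx_int: "integrable ?P Mx"
    unfolding Mx_def using T
    by (intro integrable_MAX Bochner_Integration.integrable_add Bochner_Integration.integrable_sum
        Bochner_Integration.integrable_diff comp_int f_int P.integrable_const) auto
  have sum_int: "integrable ?P (\<lambda>z. \<Sum>i<p. g (z i))" if "integrable (query_law n) g" for g :: "_ \<Rightarrow> real"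
    using comp_int[OF that] by (intro Bochner_Integration.integrable_sum) auto
  have sum_exp: "P.expectation (\<lambda>z. \<Sum>i<p. g (z i)) = p * W.expectation g" if "integrable (query_law n) g" for g :: "_ \<Rightarrow> real"
    using comp_int[OF that] comp_exp[OF that] by (subst Bochner_Integration.integral_sum) auto
  have Z_int: "integrable ?P Z"
    unfolding Z_def using Mx_int sum_int[OF q_int] sum_int[OF h_int] by simp
  have Mx_exp: "P.expectation Mx \<le> 2880 * d"
  proof -
    have "P.expectation Mx \<le> ((\<Sum>j<d. (norm (0::'a))\<^sup>2) + 4 * real p * W.expectation (\<lambda>w. \<Sum>j<d. (norm (v w j))\<^sup>2)) / (2 * (2880 * real d))
        + (2880 * real d) / 2"
      unfolding Mx_def \<mu>_def
    proof (rule W.expectation_Max_empirical_process_le[where b = 3])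
      show "\<bar>f c w - f c' w\<bar> \<le> \<bar>(\<Sum>j<d. inner (c j) (v w j)) - (\<Sum>j<d. inner (c' j) (v w j))\<bar>" for c c' w
        unfolding f_def t_def by linarith
    qed (use T v_int q_int[unfolded q_eq] d in \<open>auto simp: f_def\<close>)
    also have "\<dots> = 2880 * d"
      using q_exp d p unfolding q_eq by (simp add: field_simps)
    finally show ?thesis .
  qed
  have "P.expectation Z = P.expectation Mx * (24 / p) + p * W.expectation q / (30 * p * d) + p * W.expectation h / (30 * p * \<rho>)"
    unfolding Z_def using Mx_int sum_int[OF q_int] sum_int[OF h_int] sum_exp[OF q_int] sum_exp[OF h_int]
    by simp
  also have "\<dots> \<le> 2880 * d * (24 / p) + 1 / 30 + 1 / 30"
    using p d unfolding q_exp h_exp by (intro add_mono mult_right_mono Mx_exp) auto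
  also have "\<dots> = 1 / 10" using p d by (simp add: field_simps)
  finally have Z_exp: "P.expectation Z \<le> 1 / 10" .

  have Mx_ge: "(\<Sum>i<p. f c (z i) - \<mu> c) \<le> Mx z" if "c \<in> T" for c z
  proof -
    have "(\<Sum>j<d. inner (c j) (0::'a)) + (\<Sum>i<p. f c (z i) - \<mu> c) \<le> Mx z"
      unfolding Mx_def using T that by (intro Max_ge) auto
    then show ?thesis by simp
  qed
  have Mx_nonneg: "Mx z \<ge> 0" for z
  proof -
    have "f (\<lambda>_. 0) = (\<lambda>_. 0)" by (auto simp: f_def t_def)
    then show ?thesis using Mx_ge[of "\<lambda>_. 0" z] by (simp add: T_def \<mu>_def)
  qed
  have nn: "\<rho> \<ge> 0" "\<And>w. q w \<ge> 0" "\<And>w. h w \<ge> 0"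
    by (auto simp: \<rho>_def array_sqnorm_nonneg q_def h_def sum_nonneg)
  have nn': "Mx z * (24 / p) \<ge> 0" "(\<Sum>i<p. q (z i)) / (30 * p * d) \<ge> 0" "(\<Sum>i<p. h (z i)) / (30 * p * \<rho>) \<ge> 0" for z
    using nn(1) by (simp_all add: Mx_nonneg sum_nonneg[OF nn(2)] sum_nonneg[OF nn(3)])
  have Z_nonneg: "Z z \<ge> 0" for z
    unfolding Z_def using nn'[of z] by linarith

  define G where "G = {z \<in> space ?P. Z z < 1}"
  show ?thesis
  proof
    have [measurable]: "Z \<in> borel_measurable ?P" using Z_int by simp
    show G_sets: "G \<in> sets ?P" unfolding G_def by measurable
    have "measure ?P {z \<in> space ?P. Z z \<ge> 1} \<le> P.expectation Z / 1"
      using Z_nonneg by (intro integral_Markov_inequality_measure[OF Z_int, of "{}"]) auto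
    then have "P.prob {z \<in> space ?P. Z z \<ge> 1} \<le> 1 / 10" using Z_exp by simp
    moreover have "space ?P - G = {z \<in> space ?P. Z z \<ge> 1}" by (auto simp: G_def)
    ultimately show "measure ?P G \<ge> 9 / 10"
      using P.prob_compl[OF G_sets] by simp
  next
    fix z assume "z \<in> G"
    then have "Z z < 1" by (simp add: G_def)
    then have "(\<Sum>i<p. h (z i)) / (30 * p * \<rho>) \<le> 1"
      unfolding Z_def using nn'[of z] by linarith
    \<comment> \<open>For \<open>\<rho> = 0\<close> the quotient is 0 by convention and carries no
      information, but then \<open>R\<close> has no nonzero entry and the noise vanishes
      identically.\<close>
    then have "(\<Sum>i<p. h (z i)) \<le> 30 * p * \<rho>"
    proof (cases "\<rho> = 0")
      case True
      then show ?thesis using array_form_eq_0[of n R] by (simp add: h_def \<rho>_def)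
    next
      case False
      then show ?thesis using \<open>_ \<le> 1\<close> nn(1) p by (simp add: divide_le_eq)
    qed
    then show "(\<Sum>i<p. (norm (array_form n R (fst (z i)) (snd (z i))))\<^sup>2) \<le> 30 * real p * array_sqnorm n R"
      by (simp add: h_def \<rho>_def)
  next
    fix z and c0 :: "nat \<Rightarrow> 'a" assume "z \<in> G"
    then have "Z z < 1" by (simp add: G_def)
    then have "Mx z * (24 / p) < 1" "(\<Sum>i<p. q (z i)) / (30 * p * d) < 1"
      unfolding Z_def using nn'[of z] by linarith+
    \<comment> \<open>The allowed deviation is half of the total mean, which is at least
      \<open>p / 12\<close> at a net point.\<close>
    then have Mxz: "Mx z < p / 24" and qz: "(\<Sum>i<p. q (z i)) < 30 * p * d"
      using p d by (simp_all add: field_simps)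
    \<comment> \<open>Termwise |v| is at most (1 + |v|^2) / 2, which gives (1 + 30) / 2 < 16 times
      \<open>p * d\<close>.\<close>
    have sumv: "(\<Sum>i<p. \<Sum>j<d. norm (v (z i) j)) \<le> 16 * p * d"
    proof -
      have "(\<Sum>i<p. \<Sum>j<d. norm (v (z i) j)) \<le> (\<Sum>i<p. \<Sum>j<d. (1 + (norm (v (z i) j))\<^sup>2) / 2)"
      proof (intro sum_mono)
        fix i j
        have "0 \<le> (norm (v (z i) j) - 1)\<^sup>2" by simp
        then show "norm (v (z i) j) \<le> (1 + (norm (v (z i) j))\<^sup>2) / 2" by (simp add: power2_diff)
      qed
      also have "\<dots> = (real p * real d + (\<Sum>i<p. q (z i))) / 2"
        unfolding q_def by (simp add: sum.distrib sum_divide_distrib[symmetric])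
      also have "\<dots> \<le> 16 * p * d"
      proof -
        have "(a + b) / 2 \<le> 16 * a" if "0 \<le> a" "b < 30 * a" for a b :: real using that by argo
        from this[of "real p * real d" "\<Sum>i<p. q (z i)"]
        have "(real p * real d + (\<Sum>i<p. q (z i))) / 2 \<le> 16 * (real p * real d)"
          using qz by (simp add: mult.assoc)
        then show ?thesis by (simp add: mult.assoc)
      qed
      finally show ?thesis .
    qed
    have unit: "real p \<le> 2304 * (\<Sum>i<p. (t c (z i))\<^sup>2)" if c: "(\<Sum>j<d. (norm (c j))\<^sup>2) = 1" for c
    proof -
      obtain c' where c': "c' \<in> T0" "\<forall>j<d. norm (c j - c' j) \<le> \<delta>" using T0(3)[OF c] by blast
      have "(\<Sum>i<p. f c' (z i)) - p * \<mu> c' \<le> Mx z"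
        using Mx_ge[of c' z] c' by (simp add: T_def sum_subtractf)
      \<comment> \<open>Mean minus deviation: p/12 - p/24.\<close>
      then have "p / 24 \<le> (\<Sum>i<p. - f c' (z i))"
        using mult_left_mono[OF \<mu>_le[OF c'(1)], of "real p"] Mxz by (simp add: sum_negf)
      also have "\<dots> \<le> (\<Sum>i<p. \<bar>t c (z i)\<bar> + \<delta> * (\<Sum>j<d. norm (v (z i) j)))"
      proof (intro sum_mono)
        fix i
        have "\<bar>t c' (z i) - t c (z i)\<bar> = \<bar>\<Sum>j<d. inner (c' j - c j) (v (z i) j)\<bar>"
          unfolding t_def by (simp add: inner_diff_left sum_subtractf)
        also have "\<dots> \<le> (\<Sum>j<d. \<delta> * norm (v (z i) j))"
        proof (intro order.trans[OF sum_abs] sum_mono)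
          fix j assume "j \<in> {..<d}"
          then have "norm (c' j - c j) \<le> \<delta>" using c'(2) by (simp add: norm_minus_commute)
          then show "\<bar>inner (c' j - c j) (v (z i) j)\<bar> \<le> \<delta> * norm (v (z i) j)"
            by (intro order.trans[OF Cauchy_Schwarz_ineq2] mult_right_mono) auto
        qed
        finally show "- f c' (z i) \<le> \<bar>t c (z i)\<bar> + \<delta> * (\<Sum>j<d. norm (v (z i) j))"
          unfolding f_def sum_distrib_left by linarith
      qed
      also have "\<dots> = (\<Sum>i<p. \<bar>t c (z i)\<bar>) + \<delta> * (\<Sum>i<p. \<Sum>j<d. norm (v (z i) j))"
        by (simp add: sum.distrib sum_distrib_left)
      also have "\<dots> \<le> (\<Sum>i<p. \<bar>t c (z i)\<bar>) + \<delta> * (16 * p * d)"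
        using sumv \<delta> by (intro add_left_mono mult_left_mono) auto
      also have "\<delta> * (16 * p * d) = p / 48" using d by (simp add: \<delta>_def)
      finally have "p / 48 \<le> (\<Sum>i<p. \<bar>t c (z i)\<bar>)" by simp
      \<comment> \<open>Cauchy-Schwarz passes from the sum of absolute values to the sum of squares;
        2304 is 48^2.\<close>
      then have "(p / 48)\<^sup>2 \<le> (\<Sum>i<p. \<bar>t c (z i)\<bar> * 1)\<^sup>2" by (intro power_mono) auto
      also have "\<dots> \<le> (\<Sum>i<p. \<bar>t c (z i)\<bar>\<^sup>2) * (\<Sum>i<p. 1\<^sup>2)" by (rule Cauchy_Schwarz_ineq_sum)
      finally have "real p * p \<le> real p * (2304 * (\<Sum>i<p. (t c (z i))\<^sup>2))"
        by (simp add: power2_eq_square field_simps)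
      then show ?thesis using p(1) by (simp only: mult_le_cancel_left_pos of_nat_0_less_iff)
    qed
    let ?F = "\<lambda>c w. array_form n (\<lambda>ab. \<Sum>j<d. c j * E j ab) (fst w) (snd w)"
    have unit': "real p \<le> 2304 * (\<Sum>i<p. (norm (?F c (z i)))\<^sup>2)" if c: "(\<Sum>j<d. (norm (c j))\<^sup>2) = 1" for c
    proof -
      \<comment> \<open>Conjugating the coefficients cancels the conjugation in \<open>t_eq\<close>,
        so that \<open>t\<close> becomes the real part of \<open>?F c\<close>, which its modulus
        dominates.\<close>
      have "real p \<le> 2304 * (\<Sum>i<p. (t (\<lambda>j. conjugate (c j)) (z i))\<^sup>2)"
        by (rule unit) (use c in simp)
      also have "\<dots> \<le> 2304 * (\<Sum>i<p. (norm (?F c (z i)))\<^sup>2)"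
      proof (intro mult_left_mono sum_mono)
        fix i
        have "\<bar>t (\<lambda>j. conjugate (c j)) (z i)\<bar> \<le> norm (1::'a) * norm (?F c (z i))"
          unfolding t_eq conjugate_id by (rule Cauchy_Schwarz_ineq2)
        then have "\<bar>t (\<lambda>j. conjugate (c j)) (z i)\<bar>\<^sup>2 \<le> (norm (?F c (z i)))\<^sup>2"
          by (intro power_mono) simp_all
        then show "(t (\<lambda>j. conjugate (c j)) (z i))\<^sup>2 \<le> (norm (?F c (z i)))\<^sup>2" by simp
      qed simp
      finally show ?thesis .
    qed
    define r where "r = sqrt (\<Sum>j<d. (norm (c0 j))\<^sup>2)"
    have r: "r \<ge> 0" "r\<^sup>2 = (\<Sum>j<d. (norm (c0 j))\<^sup>2)" by (auto simp: r_def sum_nonneg)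
    show "real p * (\<Sum>j<d. (norm (c0 j))\<^sup>2) \<le> 2304 * (\<Sum>i<p. (norm (?F c0 (z i)))\<^sup>2)"
    proof (cases "r = 0")
      case True
      then show ?thesis using r by (simp add: sum_nonneg)
    next
      case False
      define c where "c j = of_real (1 / r) * c0 j" for j
      have c: "(\<Sum>j<d. (norm (c j))\<^sup>2) = 1"
      proof -
        have "(\<Sum>j<d. (norm (c j))\<^sup>2) = (\<Sum>j<d. (norm (c0 j))\<^sup>2) / r\<^sup>2"
          unfolding c_def sum_divide_distrib using r(1)
          by (simp add: norm_mult power_mult_distrib norm_divide power_divide)
        then show ?thesis unfolding r(2)[symmetric] using False by simp
      qed
      have F: "?F c w = of_real (1 / r) * ?F c0 w" for w
        unfolding array_form_lincomb c_def by (simp only: sum_distrib_left mult.assoc)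
      have "real p \<le> 2304 * (\<Sum>i<p. (norm (?F c (z i)))\<^sup>2)" by (rule unit'[OF c])
      also have "\<dots> = 2304 * (\<Sum>i<p. (norm (?F c0 (z i)))\<^sup>2) / r\<^sup>2"
        unfolding F sum_divide_distrib sum_distrib_left using r(1)
        by (simp add: norm_mult power_mult_distrib norm_divide power_divide)
      finally show ?thesis unfolding r(2)[symmetric] using False r(1)
        by (simp add: pos_le_divide_eq)
    qed
  qed
qed

end

section \<open>The pseudoinverse\<close>

lemma dim_mat_adjoint [simp]:
  "dim_row (mat_adjoint A) = dim_col A" "dim_col (mat_adjoint A) = dim_row A"
  unfolding mat_adjoint_def by auto

lemma mat_adjoint_carrier [simp]: "A \<in> carrier_mat m n \<Longrightarrow> mat_adjoint A \<in> carrier_mat n m"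
  by (rule carrier_matI) (simp_all only: dim_mat_adjoint carrier_matD)

lemma index_mat_adjoint [simp]:
  "i < dim_col A \<Longrightarrow> j < dim_row A \<Longrightarrow> mat_adjoint A $$ (i, j) = conjugate (A $$ (j, i))"
  unfolding mat_adjoint_def mat_of_rows_def by simp

lemma mat_adjoint_mult:
  assumes "A \<in> carrier_mat m n" "B \<in> carrier_mat n k"
  shows "mat_adjoint (A * B) = mat_adjoint B * mat_adjoint A"
  using assms
  by (intro eq_matI)
    (auto simp: scalar_prod_def sum_conjugate conjugate_dist_mul mult.commute intro!: sum.cong)

lemma mat_adjoint_adjoint [simp]: "mat_adjoint (mat_adjoint A) = A"
  by (intro eq_matI) auto

lemma conjugate_one [simp]: "conjugate (1 :: 'a :: conjugatable_field) = 1"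
  by (metis conjugate_dist_mul conjugate_id mult.right_neutral mult.left_neutral)

lemma mat_adjoint_one [simp]: "mat_adjoint (1\<^sub>m n :: 'a :: conjugatable_field mat) = 1\<^sub>m n"
  by (intro eq_matI) auto

text \<open>\<open>A * X\<close> and \<open>A * Y\<close> are Hermitian idempotents with the same
  range, hence equal. In the same way \<open>X * A = Y * A\<close>, as both have the kernel of
  \<open>A\<close>. Then X = X A X = X A Y = Y A Y = Y.\<close>

lemma is_pseudoinverse_unique:
  fixes A :: "'a::conjugatable_field mat"
  assumes X: "is_pseudoinverse A X" and Y: "is_pseudoinverse A Y"
  shows "X = Y"
proof -
  define p d where "p = dim_row A" and "d = dim_col A"
  have A: "A \<in> carrier_mat p d" by (simp add: p_def d_def)
  have XD: "X \<in> carrier_mat d p" "A * X * A = A" "X * A * X = X"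
      "mat_adjoint (A * X) = A * X" "mat_adjoint (X * A) = X * A"
    using X unfolding is_pseudoinverse_def p_def d_def by auto
  have YD: "Y \<in> carrier_mat d p" "A * Y * A = A" "Y * A * Y = Y"
      "mat_adjoint (A * Y) = A * Y" "mat_adjoint (Y * A) = Y * A"
    using Y unfolding is_pseudoinverse_def p_def d_def by auto
  note AX = mult_carrier_mat[OF A XD(1)] and XA = mult_carrier_mat[OF XD(1) A]
    and AY = mult_carrier_mat[OF A YD(1)] and YA = mult_carrier_mat[OF YD(1) A]
  have "A * X = (A * Y) * (A * X)"
    using assoc_mult_mat[OF AY A XD(1)] YD(2) by simp
  then have "A * X = mat_adjoint ((A * Y) * (A * X))" using XD(4) by simp
  also have "\<dots> = (A * X) * (A * Y)"
    using mat_adjoint_mult[OF AY AX] XD(4) YD(4) by simp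
  also have "\<dots> = A * Y" using assoc_mult_mat[OF AX A YD(1)] XD(2) by simp
  finally have AXY: "A * X = A * Y" .
  have "X * A = (X * A) * (Y * A)"
    using assoc_mult_mat[OF XD(1) A YA] assoc_mult_mat[OF A YD(1) A] YD(2) by simp
  then have "X * A = mat_adjoint ((X * A) * (Y * A))" using XD(5) by simp
  also have "\<dots> = (Y * A) * (X * A)"
    using mat_adjoint_mult[OF XA YA] XD(5) YD(5) by simp
  also have "\<dots> = Y * A"
    using assoc_mult_mat[OF YD(1) A XA] assoc_mult_mat[OF A XD(1) A] XD(2) by simp
  finally have XAY: "X * A = Y * A" .
  have "X = X * (A * X)" using XD(3) assoc_mult_mat[OF XD(1) A XD(1)] by simp
  also have "\<dots> = (X * A) * Y" unfolding AXY using assoc_mult_mat[OF XD(1) A YD(1)] by simp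
  also have "\<dots> = Y" unfolding XAY by (rule YD(3))
  finally show ?thesis .
qed

lemma pseudoinverse_eqI: "is_pseudoinverse A X \<Longrightarrow> pseudoinverse A = X"
  unfolding pseudoinverse_def by (blast intro: the_equality is_pseudoinverse_unique)

lemma sum_inner_mult_mat_vec:
  fixes A :: "'a::real_or_complex mat"
  assumes A: "A \<in> carrier_mat p d" and v: "v \<in> carrier_vec d" and u: "u \<in> carrier_vec p"
  shows "(\<Sum>i<p. inner ((A *\<^sub>v v) $ i) (u $ i)) = (\<Sum>j<d. inner (v $ j) ((mat_adjoint A *\<^sub>v u) $ j))"
proof -
  have e: "inner (a * b) c = inner b (conjugate a * c)" for a b c :: 'a
    by (metis inner_commute inner_mult_left)
  have "(\<Sum>i<p. inner ((A *\<^sub>v v) $ i) (u $ i)) = (\<Sum>i<p. \<Sum>j<d. inner (v $ j) (conjugate (A $$ (i, j)) * u $ i))"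
    using A v by (intro sum.cong refl) (simp add: scalar_prod_def inner_sum_left e lessThan_atLeast0)
  also have "\<dots> = (\<Sum>j<d. \<Sum>i<p. inner (v $ j) (conjugate (A $$ (i, j)) * u $ i))"
    by (rule sum.swap)
  also have "\<dots> = (\<Sum>j<d. inner (v $ j) ((mat_adjoint A *\<^sub>v u) $ j))"
    using A u by (intro sum.cong refl) (simp add: scalar_prod_def inner_sum_right lessThan_atLeast0)
  finally show ?thesis .
qed

text \<open>The witness is the least squares formula (A^H A)^{-1} A^H with A^H the adjoint. The Gram
  matrix is invertible: if it annihilates \<open>v\<close>, then |A v|^2 = 0, and injectivity gives
  \<open>v = 0\<close>.\<close>

lemma injective_is_pseudoinverse:
  fixes A :: "'a::real_or_complex mat"
  assumes A: "A \<in> carrier_mat p d"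
    and inj: "\<And>v. v \<in> carrier_vec d \<Longrightarrow> A *\<^sub>v v = 0\<^sub>v p \<Longrightarrow> v = 0\<^sub>v d"
  obtains X where "is_pseudoinverse A X" "X * A = 1\<^sub>m d"
proof -
  let ?H = "mat_adjoint A"
  define G where "G = ?H * A"
  have H: "?H \<in> carrier_mat d p" and G: "G \<in> carrier_mat d d" using A by (auto simp: G_def)
  have "v = 0\<^sub>v d" if v: "v \<in> carrier_vec d" and Gv: "G *\<^sub>v v = 0\<^sub>v d" for v
  proof (rule inj[OF v])
    have Av: "A *\<^sub>v v \<in> carrier_vec p" using A v by simp
    have "(\<Sum>i<p. inner ((A *\<^sub>v v) $ i) ((A *\<^sub>v v) $ i)) = (\<Sum>j<d. inner (v $ j) ((G *\<^sub>v v) $ j))"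
      unfolding sum_inner_mult_mat_vec[OF A v Av] G_def assoc_mult_mat_vec[OF H A v] ..
    also have "\<dots> = 0" by (simp add: Gv)
    finally have "\<forall>i<p. (A *\<^sub>v v) $ i = 0" by (simp add: sum_nonneg_eq_0_iff)
    then show "A *\<^sub>v v = 0\<^sub>v p" using Av A by (intro eq_vecI) auto
  qed
  then have "det G \<noteq> 0" unfolding det_0_iff_vec_prod_zero_field[OF G] by blast
  from det_non_zero_imp_unit[OF G this, of "()"]
  obtain V where V: "V \<in> carrier_mat d d" "V * G = 1\<^sub>m d" "G * V = 1\<^sub>m d"
    unfolding Units_def ring_mat_def by auto
  have GH: "mat_adjoint G = G" unfolding G_def using mat_adjoint_mult[OF H A] by simp
  have VH: "mat_adjoint V = V"
  proof -
    have "mat_adjoint V = mat_adjoint V * (G * V)" using V by simp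
    also have "\<dots> = (mat_adjoint V * G) * V"
      using V G by (intro assoc_mult_mat[symmetric]) auto
    also have "mat_adjoint V * G = mat_adjoint (G * V)"
      using mat_adjoint_mult[OF G V(1)] GH by simp
    finally show ?thesis using V by simp
  qed
  define X where "X = V * ?H"
  have X: "X \<in> carrier_mat d p" using V H by (simp add: X_def)
  have XA: "X * A = 1\<^sub>m d"
    unfolding X_def using assoc_mult_mat[OF V(1) H A] V(2) by (simp add: G_def)
  show ?thesis
  proof
    show "is_pseudoinverse A X"
      unfolding is_pseudoinverse_def
    proof (intro conjI)
      show "X \<in> carrier_mat (dim_col A) (dim_row A)" using X A by auto
      show "A * X * A = A" using assoc_mult_mat[OF A X A] XA A by simp
      show "X * A * X = X" using XA X by simp
      show "mat_adjoint (X * A) = X * A" by (simp add: XA)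
      have "mat_adjoint (A * X) = mat_adjoint (V * ?H) * ?H"
        using mat_adjoint_mult[OF A X] by (simp add: X_def)
      also have "\<dots> = (A * V) * ?H" using mat_adjoint_mult[OF V(1) H] VH by simp
      also have "\<dots> = A * X" unfolding X_def by (rule assoc_mult_mat[OF A V(1) H])
      finally show "mat_adjoint (A * X) = A * X" .
    qed
    show "X * A = 1\<^sub>m d" by (rule XA)
  qed
qed

text \<open>The residual \<open>A u - h\<close> is orthogonal to the range of \<open>A\<close>, so \<open>A u\<close> is a projection of the noise \<open>h\<close>.\<close>

lemma pseudoinverse_noise_bound:
  fixes A :: "'a::real_or_complex mat"
  assumes A: "A \<in> carrier_mat p d"
    and inj: "\<And>v. v \<in> carrier_vec d \<Longrightarrow> A *\<^sub>v v = 0\<^sub>v p \<Longrightarrow> v = 0\<^sub>v d"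
    and c: "c \<in> carrier_vec d" and h: "h \<in> carrier_vec p"
  defines "u \<equiv> pseudoinverse A *\<^sub>v (A *\<^sub>v c + h) - c"
  shows "u \<in> carrier_vec d" and "(\<Sum>i<p. (norm ((A *\<^sub>v u) $ i))\<^sup>2) \<le> (\<Sum>i<p. (norm (h $ i))\<^sup>2)"
proof -
  obtain X where X: "is_pseudoinverse A X" "X * A = 1\<^sub>m d"
    using injective_is_pseudoinverse[OF A inj] .
  have XD: "X \<in> carrier_mat d p" "A * X * A = A" "mat_adjoint (A * X) = A * X"
    using X(1) A unfolding is_pseudoinverse_def by auto
  let ?H = "mat_adjoint A"
  have H: "?H \<in> carrier_mat d p" using A by simp
  have Ac: "A *\<^sub>v c \<in> carrier_vec p" using A c by simp
  have "X *\<^sub>v (A *\<^sub>v c + h) = X *\<^sub>v (A *\<^sub>v c) + X *\<^sub>v h"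
    by (rule mult_add_distrib_mat_vec[OF XD(1) Ac h])
  also have "X *\<^sub>v (A *\<^sub>v c) = c"
    using assoc_mult_mat_vec[OF XD(1) A c] X(2) c by simp
  \<comment> \<open>The left inverse recovers \<open>c\<close> exactly, so the coefficient error
    depends on the noise alone.\<close>
  finally have u: "u = X *\<^sub>v h"
    unfolding u_def pseudoinverse_eqI[OF X(1)] using c XD(1) h by (intro eq_vecI) auto
  show ucarr: "u \<in> carrier_vec d" unfolding u using XD(1) h by simp
  have Au: "A *\<^sub>v u \<in> carrier_vec p" using A ucarr by simp
  \<comment> \<open>The normal equations: \<open>A * X\<close> is Hermitian and fixes the columns of
    \<open>A\<close>.\<close>
  have HAX: "?H * (A * X) = ?H"
    using mat_adjoint_mult[OF mult_carrier_mat[OF A XD(1)] A] XD(2,3) by simp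
  have "?H *\<^sub>v (A *\<^sub>v u) = (?H * (A * X)) *\<^sub>v h"
    unfolding u using assoc_mult_mat_vec[OF A XD(1) h] assoc_mult_mat_vec[OF H mult_carrier_mat[OF A XD(1)] h] by simp
  then have HAu: "?H *\<^sub>v (A *\<^sub>v u) = ?H *\<^sub>v h" unfolding HAX .
  \<comment> \<open>By the normal equations |A u|^2 is the inner product of A u and
    \<open>h\<close>, at most (|A u|^2 + |h|^2) / 2.\<close>
  have "(\<Sum>i<p. (norm ((A *\<^sub>v u) $ i))\<^sup>2) = (\<Sum>i<p. inner ((A *\<^sub>v u) $ i) (h $ i))"
    unfolding power2_norm_eq_inner sum_inner_mult_mat_vec[OF A ucarr Au] sum_inner_mult_mat_vec[OF A ucarr h] HAu ..
  also have "\<dots> \<le> (\<Sum>i<p. ((norm ((A *\<^sub>v u) $ i))\<^sup>2 + (norm (h $ i))\<^sup>2) / 2)"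
  proof (rule sum_mono)
    fix i
    have "0 \<le> (norm ((A *\<^sub>v u) $ i - h $ i))\<^sup>2" by simp
    also have "\<dots> = (norm ((A *\<^sub>v u) $ i))\<^sup>2 + (norm (h $ i))\<^sup>2 - 2 * inner ((A *\<^sub>v u) $ i) (h $ i)"
      unfolding power2_norm_eq_inner by (simp add: inner_diff_left inner_diff_right inner_commute)
    finally show "inner ((A *\<^sub>v u) $ i) (h $ i) \<le> ((norm ((A *\<^sub>v u) $ i))\<^sup>2 + (norm (h $ i))\<^sup>2) / 2" by simp
  qed
  also have "\<dots> = ((\<Sum>i<p. (norm ((A *\<^sub>v u) $ i))\<^sup>2) + (\<Sum>i<p. (norm (h $ i))\<^sup>2)) / 2"
    by (simp add: sum.distrib sum_divide_distrib[symmetric])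
  finally show "(\<Sum>i<p. (norm ((A *\<^sub>v u) $ i))\<^sup>2) \<le> (\<Sum>i<p. (norm (h $ i))\<^sup>2)" by simp
qed

section \<open>Orthonormal bases and projections\<close>

definition herm :: "'i set \<Rightarrow> ('i \<Rightarrow> 'a::conjugatable_field) \<Rightarrow> ('i \<Rightarrow> 'a) \<Rightarrow> 'a" where
  "herm I f g = (\<Sum>i\<in>I. conjugate (f i) * g i)"

text \<open>Only the values on \<open>I\<close> are constrained. Matrix entries can thus be read as
  a function on all index pairs, whatever it yields outside the matrix.\<close>

definition lincombs :: "'i set \<Rightarrow> (nat \<Rightarrow> 'i \<Rightarrow> 'a::field) \<Rightarrow> nat \<Rightarrow> ('i \<Rightarrow> 'a) set" where
  "lincombs I V d = {f. \<exists>c. \<forall>i\<in>I. f i = (\<Sum>j<d. c j * V j i)}"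

lemma lincombsI: "(\<And>i. i \<in> I \<Longrightarrow> f i = (\<Sum>j<d. c j * V j i)) \<Longrightarrow> f \<in> lincombs I V d"
  unfolding lincombs_def by blast

lemma lincombs_add: "f \<in> lincombs I V d \<Longrightarrow> g \<in> lincombs I V d \<Longrightarrow> (\<lambda>i. f i + g i) \<in> lincombs I V d"
proof -
  assume "f \<in> lincombs I V d" "g \<in> lincombs I V d"
  then obtain a b where "\<And>i. i \<in> I \<Longrightarrow> f i = (\<Sum>j<d. a j * V j i)" "\<And>i. i \<in> I \<Longrightarrow> g i = (\<Sum>j<d. b j * V j i)"
    unfolding lincombs_def by blast
  then show ?thesis
    by (intro lincombsI[where c = "\<lambda>j. a j + b j"]) (simp add: sum.distrib distrib_right)
qed

lemma lincombs_scale: "f \<in> lincombs I V d \<Longrightarrow> (\<lambda>i. a * f i) \<in> lincombs I V d"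
proof -
  assume "f \<in> lincombs I V d"
  then obtain b where "\<And>i. i \<in> I \<Longrightarrow> f i = (\<Sum>j<d. b j * V j i)"
    unfolding lincombs_def by blast
  then show ?thesis
    by (intro lincombsI[where c = "\<lambda>j. a * b j"]) (simp add: sum_distrib_left mult.assoc)
qed

lemma lincombs_sum:
  "(\<And>k. k < (m::nat) \<Longrightarrow> f k \<in> lincombs I V d) \<Longrightarrow> (\<lambda>i. \<Sum>k<m. f k i) \<in> lincombs I V d"
proof (induction m)
  case 0
  show ?case by (rule lincombsI[where c = "\<lambda>_. 0"]) simp
next
  case (Suc m)
  then show ?case using lincombs_add[of "\<lambda>i. \<Sum>k<m. f k i" I V d "f m"] by simp
qed

lemma lincombs_member: "j < d \<Longrightarrow> V j \<in> lincombs I V d"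
  by (rule lincombsI[where c = "\<lambda>k. if k = j then 1 else 0"])
    (simp add: if_distrib[of "\<lambda>x. x * _"] cong: if_cong)

lemma lincombs_cong: "(\<And>i. i \<in> I \<Longrightarrow> f i = g i) \<Longrightarrow> f \<in> lincombs I V d \<Longrightarrow> g \<in> lincombs I V d"
  unfolding lincombs_def by auto

lemma lincombs_subset:
  assumes "\<And>j. j < d \<Longrightarrow> V j \<in> lincombs I U e"
  shows "lincombs I V d \<subseteq> lincombs I U e"
proof
  fix f assume "f \<in> lincombs I V d"
  then obtain c where c: "\<And>i. i \<in> I \<Longrightarrow> f i = (\<Sum>j<d. c j * V j i)" unfolding lincombs_def by blast
  have "(\<lambda>i. \<Sum>j<d. c j * V j i) \<in> lincombs I U e"
    by (intro lincombs_sum lincombs_scale assms)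
  then show "f \<in> lincombs I U e" by (rule lincombs_cong[rotated]) (simp add: c)
qed

lemma lincombs_Suc: "lincombs I V d \<subseteq> lincombs I V (Suc d)"
  by (intro lincombs_subset lincombs_member) simp

lemma herm_diff_right: "herm I f (\<lambda>i. g i - h i) = herm I f g - herm I f h"
  by (simp add: herm_def sum_subtractf right_diff_distrib)

lemma herm_scale_right: "herm I f (\<lambda>i. a * g i) = a * herm I f g"
  by (simp add: herm_def sum_distrib_left mult.left_commute)

lemma herm_sum_right: "herm I f (\<lambda>i. \<Sum>j\<in>J. g j i) = (\<Sum>j\<in>J. herm I f (g j))"
  unfolding herm_def by (simp add: sum_distrib_left) (rule sum.swap)

lemma conjugate_herm: "finite I \<Longrightarrow> conjugate (herm I f g) = herm I g f"
  by (simp add: herm_def sum_conjugate conjugate_dist_mul mult.commute)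

lemma herm_self:
  fixes f :: "'i \<Rightarrow> 'a::real_or_complex"
  shows "herm I f f = (\<Sum>i\<in>I. (norm (f i))\<^sup>2) *\<^sub>R 1"
  by (simp add: herm_def conjugate_mult_self scaleR_sum_left)

lemma sum_inner_eq_herm:
  fixes f g :: "'i \<Rightarrow> 'a::real_or_complex"
  shows "(\<Sum>i\<in>I. inner (f i) (g i)) = inner 1 (herm I f g)"
  by (simp add: herm_def inner_sum_right inner_mult)

definition orthonormal :: "'i set \<Rightarrow> (nat \<Rightarrow> 'i \<Rightarrow> 'a::conjugatable_field) \<Rightarrow> nat \<Rightarrow> bool" where
  "orthonormal I E d \<longleftrightarrow> (\<forall>j<d. \<forall>k<d. herm I (E j) (E k) = (if j = k then 1 else 0))"

lemma herm_orthonormal_lincomb: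
  assumes "orthonormal I E d" "k < d"
  shows "herm I (E k) (\<lambda>i. \<Sum>j<d. c j * E j i) = c k"
proof -
  have "herm I (E k) (\<lambda>i. \<Sum>j<d. c j * E j i) = (\<Sum>j<d. c j * herm I (E k) (E j))"
    by (simp add: herm_sum_right herm_scale_right)
  also have "\<dots> = (\<Sum>j<d. if j = k then c j else 0)"
    using assms unfolding orthonormal_def by (intro sum.cong) auto
  finally show ?thesis using assms(2) by simp
qed

lemma norm_square_orthonormal_lincomb:
  fixes E :: "nat \<Rightarrow> 'i \<Rightarrow> 'a::real_or_complex"
  assumes "finite I" "orthonormal I E d"
  shows "(\<Sum>i\<in>I. (norm (\<Sum>j<d. c j * E j i))\<^sup>2) = (\<Sum>j<d. (norm (c j))\<^sup>2)"
proof -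
  let ?f = "\<lambda>i. \<Sum>j<d. c j * E j i"
  have "herm I ?f ?f = (\<Sum>j<d. c j * herm I ?f (E j))"
    by (simp add: herm_sum_right herm_scale_right)
  also have "\<dots> = (\<Sum>j<d. conjugate (c j) * c j)"
  proof (rule sum.cong)
    fix j assume "j \<in> {..<d}"
    then have "herm I ?f (E j) = conjugate (c j)"
      using herm_orthonormal_lincomb[OF assms(2), of j c] conjugate_herm[OF assms(1), of "E j" ?f] by simp
    then show "c j * herm I ?f (E j) = conjugate (c j) * c j" by (simp only: mult.commute)
  qed simp
  also have "\<dots> = (\<Sum>j<d. (norm (c j))\<^sup>2) *\<^sub>R 1"
    by (simp add: conjugate_mult_self scaleR_sum_left)
  finally have "(\<Sum>i\<in>I. (norm (?f i))\<^sup>2) *\<^sub>R (1::'a) = (\<Sum>j<d. (norm (c j))\<^sup>2) *\<^sub>R 1"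
    unfolding herm_self .
  then show ?thesis by simp
qed

text \<open>Gram-Schmidt: the new vector is the normalized remainder of \<open>V d\<close> after
  projection to the earlier ones. A vanishing remainder would be a linear relation in which
  \<open>V d\<close> has coefficient -1.\<close>

lemma orthonormal_basis_exists:
  fixes V :: "nat \<Rightarrow> 'i \<Rightarrow> 'a::real_or_complex"
  assumes I: "finite I"
    and indep: "\<And>c. (\<forall>i\<in>I. (\<Sum>j<d. c j * V j i) = 0) \<Longrightarrow> \<forall>j<d. c j = 0"
  shows "\<exists>E. orthonormal I E d \<and> lincombs I E d = lincombs I V d"
  using indep
proof (induction d)
  case 0
  show ?case by (intro exI[of _ V]) (simp add: orthonormal_def)
next
  case (Suc d)
  have "\<forall>j<d. c j = 0" if c: "\<forall>i\<in>I. (\<Sum>j<d. c j * V j i) = 0" for c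
  proof (intro allI impI)
    fix j assume "j < d"
    have "\<forall>j<Suc d. (if j = d then 0 else c j) = 0" by (rule Suc.prems) (use c in simp)
    from this[rule_format, of j] \<open>j < d\<close> show "c j = 0" by simp
  qed
  from Suc.IH[OF this] obtain E where E: "orthonormal I E d" "lincombs I E d = lincombs I V d" by auto
  define s where "s = (\<lambda>i. \<Sum>k<d. herm I (E k) (V d) * E k i)"
  define r where "r = (\<lambda>i. V d i - s i)"
  define \<nu> where "\<nu> = sqrt (\<Sum>i\<in>I. (norm (r i))\<^sup>2)"
  define a :: 'a where "a = of_real (1 / \<nu>)"
  define E' where "E' = E(d := \<lambda>i. a * r i)"
  have s: "s \<in> lincombs I E d" unfolding s_def by (rule lincombsI) simp
  have Er: "herm I (E k) r = 0" if "k < d" for k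
    unfolding r_def herm_diff_right s_def herm_orthonormal_lincomb[OF E(1) that] by simp
  have nz: "\<nu> \<noteq> 0"
  proof
    assume "\<nu> = 0"
    then have "\<forall>i\<in>I. V d i = s i" using I by (simp add: \<nu>_def sum_nonneg_eq_0_iff r_def)
    then have "V d \<in> lincombs I V d" using s lincombs_cong[of I s "V d"] E(2) by auto
    then obtain c where c: "\<And>i. i \<in> I \<Longrightarrow> V d i = (\<Sum>j<d. c j * V j i)" unfolding lincombs_def by blast
    have "\<forall>i\<in>I. (\<Sum>j<Suc d. (if j = d then - 1 else c j) * V j i) = 0" using c by simp
    from Suc.prems[OF this] show False by auto
  qed
  have \<nu>2: "\<nu>\<^sup>2 = (\<Sum>i\<in>I. (norm (r i))\<^sup>2)" by (simp add: \<nu>_def sum_nonneg)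
  have dd: "herm I (E' d) (E' d) = 1"
  proof -
    have "(\<Sum>i\<in>I. (norm (E' d i))\<^sup>2) = (\<Sum>i\<in>I. (norm (r i))\<^sup>2 / \<nu>\<^sup>2)"
      by (simp add: E'_def a_def norm_mult power_mult_distrib norm_divide power_divide)
    also have "\<dots> = 1" unfolding sum_divide_distrib[symmetric] \<nu>2[symmetric] using nz by simp
    finally show ?thesis by (simp add: herm_self)
  qed
  have kd: "herm I (E k) (E' d) = 0" "herm I (E' d) (E k) = 0" if "k < d" for k
  proof -
    show 1: "herm I (E k) (E' d) = 0" using Er[OF that] by (simp add: E'_def herm_scale_right)
    show "herm I (E' d) (E k) = 0" using conjugate_herm[OF I, of "E k" "E' d"] 1 by simp
  qed
  have "orthonormal I E' (Suc d)"
    unfolding orthonormal_def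
  proof (intro allI impI)
    fix j k assume "j < Suc d" "k < Suc d"
    then consider "j = d" "k = d" | "j = d" "k < d" | "j < d" "k = d" | "j < d" "k < d" by linarith
    then show "herm I (E' j) (E' k) = (if j = k then 1 else 0)"
    proof cases
      case 1 then show ?thesis using dd by simp
    next
      case 2 then show ?thesis using kd(2)[of k] by (simp add: E'_def)
    next
      case 3 then show ?thesis using kd(1)[of j] by (simp add: E'_def)
    next
      case 4 then show ?thesis using E(1) by (simp add: E'_def orthonormal_def)
    qed
  qed
  moreover have "lincombs I E' (Suc d) = lincombs I V (Suc d)"
  proof
    have E_V: "lincombs I E d \<subseteq> lincombs I V (Suc d)" using E(2) lincombs_Suc[of I V d] by simp
    show "lincombs I E' (Suc d) \<subseteq> lincombs I V (Suc d)"
    proof (rule lincombs_subset)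
      fix j assume j: "j < Suc d"
      show "E' j \<in> lincombs I V (Suc d)"
      proof (cases "j = d")
        case True
        have "(\<lambda>i. a * (V d i + (- 1) * s i)) \<in> lincombs I V (Suc d)"
          using s E_V by (intro lincombs_scale lincombs_add lincombs_member) auto
        then show ?thesis using True by (simp add: E'_def r_def)
      next
        case False
        then have "E j \<in> lincombs I E d" using j by (intro lincombs_member) simp
        then show ?thesis using False E_V by (auto simp: E'_def)
      qed
    qed
    have "lincombs I E d \<subseteq> lincombs I E' (Suc d)"
    proof (rule lincombs_subset)
      fix j assume "j < d"
      then show "E j \<in> lincombs I E' (Suc d)" using lincombs_member[of j "Suc d" E' I] by (simp add: E'_def)
    qed
    then have E_E': "lincombs I V d \<subseteq> lincombs I E' (Suc d)" "s \<in> lincombs I E' (Suc d)" using E(2) s by auto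
    show "lincombs I V (Suc d) \<subseteq> lincombs I E' (Suc d)"
    proof (rule lincombs_subset)
      fix j assume j: "j < Suc d"
      show "V j \<in> lincombs I E' (Suc d)"
      proof (cases "j = d")
        case True
        have "(\<lambda>i. of_real \<nu> * E' d i + s i) \<in> lincombs I E' (Suc d)"
          using E_E' by (intro lincombs_scale lincombs_add lincombs_member) auto
        moreover have "(\<lambda>i. of_real \<nu> * E' d i + s i) = V d"
          using nz by (simp add: E'_def a_def r_def fun_eq_iff)
        ultimately show ?thesis using True by simp
      next
        case False
        then have "V j \<in> lincombs I V d" using j by (intro lincombs_member) simp
        then show ?thesis using E_E' by auto
      qed
    qed
  qed
  ultimately show ?case by blast
qed

text \<open>The \<open>b j\<close> are the Fourier coefficients of \<open>B\<close>. Having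
  Pythagoras for every \<open>s\<close> in the span serves two purposes: it shows that the residual
  is the smallest possible, and it splits the error of the recovered matrix.\<close>

lemma orthonormal_projection:
  fixes E :: "nat \<Rightarrow> 'i \<Rightarrow> 'a::real_or_complex" and B :: "'i \<Rightarrow> 'a"
  assumes I: "finite I" and E: "orthonormal I E d"
  obtains b where "\<And>s. s \<in> lincombs I E d \<Longrightarrow>
    (\<Sum>i\<in>I. (norm (B i - (\<Sum>j<d. b j * E j i) + s i))\<^sup>2)
      = (\<Sum>i\<in>I. (norm (B i - (\<Sum>j<d. b j * E j i)))\<^sup>2) + (\<Sum>i\<in>I. (norm (s i))\<^sup>2)"
proof
  define b where "b j = herm I (E j) B" for j
  define R where "R = (\<lambda>i. B i - (\<Sum>j<d. b j * E j i))"
  fix s assume "s \<in> lincombs I E d"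
  then obtain c where c: "\<And>i. i \<in> I \<Longrightarrow> s i = (\<Sum>j<d. c j * E j i)" unfolding lincombs_def by blast
  have ER: "herm I R (E j) = 0" if "j < d" for j
  proof -
    have "herm I (E j) R = 0"
      unfolding R_def herm_diff_right herm_orthonormal_lincomb[OF E that] by (simp add: b_def)
    then show ?thesis using conjugate_herm[OF I, of "E j" R] by simp
  qed
  have "herm I R s = herm I R (\<lambda>i. \<Sum>j<d. c j * E j i)" unfolding herm_def using c by simp
  also have "\<dots> = 0" using ER by (simp add: herm_sum_right herm_scale_right)
  finally have "(\<Sum>i\<in>I. inner (R i) (s i)) = 0" by (simp add: sum_inner_eq_herm)
  moreover have "(norm (R i + s i))\<^sup>2 = (norm (R i))\<^sup>2 + (norm (s i))\<^sup>2 + 2 * inner (R i) (s i)" for i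
    unfolding power2_norm_eq_inner by (simp add: inner_add_left inner_add_right inner_commute)
  ultimately show "(\<Sum>i\<in>I. (norm (B i - (\<Sum>j<d. b j * E j i) + s i))\<^sup>2)
      = (\<Sum>i\<in>I. (norm (B i - (\<Sum>j<d. b j * E j i)))\<^sup>2) + (\<Sum>i\<in>I. (norm (s i))\<^sup>2)"
    unfolding R_def by (simp add: sum.distrib sum_distrib_left[symmetric])
qed

section \<open>Measurability\<close>

text \<open>The tube lemma: projecting along a compact factor is a closed map.\<close>

lemma closed_projection_of_compact:
  fixes C :: "('a::topological_space \<times> 'b::topological_space) set"
  assumes C: "closed C" and S: "compact S"
  shows "closed {x. \<exists>y\<in>S. (x, y) \<in> C}"
proof -
  have "closedin (prod_topology euclidean (subtopology euclidean S)) (C \<inter> UNIV \<times> S)"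
  proof -
    have "prod_topology euclidean (subtopology euclidean S) = subtopology (euclidean :: ('a \<times> 'b) topology) (UNIV \<times> S)"
      using prod_topology_subtopology(2)[of "euclidean :: 'a topology" "euclidean :: 'b topology" S] by simp
    then show ?thesis using C by (auto simp: closedin_subtopology)
  qed
  then have "closedin euclidean (fst ` (C \<inter> UNIV \<times> S))"
    using closed_map_fst[of "subtopology euclidean S" "euclidean :: 'a topology"] S
    by (simp add: closed_map_def compact_space_subtopology)
  moreover have "fst ` (C \<inter> UNIV \<times> S) = {x. \<exists>y\<in>S. (x, y) \<in> C}" by force
  ultimately show ?thesis by simp
qed

text \<open>Tychonoff's theorem, once for each index.\<close>

lemma compact_bounded_arrays:
  "compact {\<xi> :: nat \<Rightarrow> nat \<Rightarrow> 'a::euclidean_space. \<forall>i j. norm (\<xi> i j) \<le> K}"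
proof -
  have 1: "compact (PiE UNIV (\<lambda>_::nat. cball (0::'a) K))"
    using compactin_PiE[of "\<lambda>_::nat. euclidean :: 'a topology" UNIV "\<lambda>_. cball 0 K"]
    by (simp add: euclidean_product_topology)
  have "compact (PiE UNIV (\<lambda>_::nat. PiE UNIV (\<lambda>_::nat. cball (0::'a) K)))"
    using compactin_PiE[of "\<lambda>_::nat. euclidean :: (nat \<Rightarrow> 'a) topology" UNIV "\<lambda>_. PiE UNIV (\<lambda>_::nat. cball (0::'a) K)"] 1
    by (simp add: euclidean_product_topology)
  moreover have "PiE UNIV (\<lambda>_::nat. PiE UNIV (\<lambda>_::nat. cball (0::'a) K)) = {\<xi>. \<forall>i j. norm (\<xi> i j) \<le> K}"
    by (auto simp: PiE_iff)
  ultimately show ?thesis by simp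
qed

lemma continuous_on_conjugate [continuous_intros]:
  assumes "continuous_on S f"
  shows "continuous_on S (\<lambda>x. conjugate (f x :: 'a::real_or_complex))"
proof -
  have "dist (conjugate a) (conjugate b) = dist a b" for a b :: 'a
  proof -
    have "conjugate a - conjugate b = conjugate (a - b)"
      using conjugate_dist_add[of a "- b"] by (simp add: conjugate_neg)
    then show ?thesis by (simp add: dist_norm)
  qed
  then have "continuous_on UNIV (conjugate :: 'a \<Rightarrow> 'a)"
    by (auto simp: continuous_on_iff)
  from continuous_on_compose2[OF this assms] show ?thesis by simp
qed

text \<open>Reading past the end of a vector gives a value determined by the dimension and the
  index, independent of the entries. Such a reading is therefore constant in the random input, and
  measurable.\<close>

lemma vec_index_ge_dim: "m \<le> j \<Longrightarrow> vec m f $ j = vec m g $ j"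
  by transfer (simp add: mk_vec_def)

lemma array_coordinate_continuous:
  fixes z :: "'x::topological_space \<Rightarrow> nat \<Rightarrow> nat \<Rightarrow> 'b::topological_space"
  shows "continuous_on S z \<Longrightarrow> continuous_on S (\<lambda>x. z x i j)"
  by (rule continuous_on_product_then_coordinatewise[OF continuous_on_product_then_coordinatewise])

text \<open>The first \<open>d\<close> columns of an array \<open>z\<close> hold the query matrix, column \<open>d\<close> the responses.
The graph of \<open>pseudoinverse\<close> is closed although \<open>pseudoinverse\<close> is discontinuous, so preimages
of compact sets are closed. No existence result for pseudoinverses is needed: where none exists,
\<open>THE\<close> yields one fixed matrix.\<close>

lemma borel_recovery_event:
  fixes B :: "'a::real_or_complex mat" and M :: "nat \<Rightarrow> 'a mat"
  assumes B: "B \<in> carrier_mat n n"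
  shows "{z :: nat \<Rightarrow> nat \<Rightarrow> 'a. frobenius_norm (B - mat_lincomb n d
      (vec_index (pseudoinverse (mat p d (\<lambda>(i, j). z i j)) *\<^sub>v vec p (\<lambda>i. z i d))) M) \<le> r} \<in> sets borel"
proof -
  define F :: "(nat \<Rightarrow> nat \<Rightarrow> 'a) \<Rightarrow> 'a mat" where "F z = mat p d (\<lambda>(i, j). z i j)" for z
  define X :: "(nat \<Rightarrow> nat \<Rightarrow> 'a) \<Rightarrow> 'a mat" where "X \<xi> = mat d p (\<lambda>(i, j). \<xi> i j)" for \<xi>
  define g where "g z = vec p (\<lambda>i. z i d)" for z :: "nat \<Rightarrow> nat \<Rightarrow> 'a"
  define err where "err c = sqrt (\<Sum>i<n. \<Sum>j<n. (norm (B $$ (i, j) - (\<Sum>l<d. c l * M l $$ (i, j))))\<^sup>2)" for c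
  have err: "frobenius_norm (B - mat_lincomb n d c M) = err c" for c
    unfolding frobenius_norm_def err_def mat_lincomb_def using B
    by (intro arg_cong[where f = sqrt]) simp
  define C where "C = {w. is_pseudoinverse (F (fst w)) (X (snd w))}"
  \<comment> \<open>The error is written through the candidate inverse \<open>snd w\<close> rather
    than through \<open>pseudoinverse\<close>, which makes it continuous in \<open>w\<close> and
    \<open>C'\<close> closed.\<close>
  define C' where "C' = {w. is_pseudoinverse (F (fst w)) (X (snd w)) \<and> err (\<lambda>j. \<Sum>k<p. snd w j k * fst w k d) \<le> r}"
  define S where "S K = {\<xi> :: nat \<Rightarrow> nat \<Rightarrow> 'a. \<forall>i j. norm (\<xi> i j) \<le> real K}" for K
  have fst_c: "continuous_on UNIV (\<lambda>w :: (nat \<Rightarrow> nat \<Rightarrow> 'a) \<times> (nat \<Rightarrow> nat \<Rightarrow> 'a). fst w i j)" for i j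
    by (rule array_coordinate_continuous[OF continuous_on_fst[OF continuous_on_id]])
  have snd_c: "continuous_on UNIV (\<lambda>w :: (nat \<Rightarrow> nat \<Rightarrow> 'a) \<times> (nat \<Rightarrow> nat \<Rightarrow> 'a). snd w i j)" for i j
    by (rule array_coordinate_continuous[OF continuous_on_snd[OF continuous_on_id]])
  \<comment> \<open>In coordinates the Penrose conditions are finitely many equations between
    continuous functions of both arrays.\<close>
  have pinv: "is_pseudoinverse (F z) (X \<xi>) \<longleftrightarrow>
     (\<forall>i j. i < p \<longrightarrow> j < d \<longrightarrow> (\<Sum>k<p. (\<Sum>l<d. z i l * \<xi> l k) * z k j) = z i j) \<and>
     (\<forall>i j. i < d \<longrightarrow> j < p \<longrightarrow> (\<Sum>k<d. (\<Sum>l<p. \<xi> i l * z l k) * \<xi> k j) = \<xi> i j) \<and>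
     (\<forall>i j. i < p \<longrightarrow> j < p \<longrightarrow> conjugate (\<Sum>l<d. z j l * \<xi> l i) = (\<Sum>l<d. z i l * \<xi> l j)) \<and>
     (\<forall>i j. i < d \<longrightarrow> j < d \<longrightarrow> conjugate (\<Sum>l<p. \<xi> j l * z l i) = (\<Sum>l<p. \<xi> i l * z l j))" for z \<xi>
  proof -
    have 1: "F z * X \<xi> * F z = F z \<longleftrightarrow> (\<forall>i j. i < p \<longrightarrow> j < d \<longrightarrow> (\<Sum>k<p. (\<Sum>l<d. z i l * \<xi> l k) * z k j) = z i j)"
      unfolding mat_eq_iff by (simp add: F_def X_def scalar_prod_def lessThan_atLeast0)
    have 2: "X \<xi> * F z * X \<xi> = X \<xi> \<longleftrightarrow> (\<forall>i j. i < d \<longrightarrow> j < p \<longrightarrow> (\<Sum>k<d. (\<Sum>l<p. \<xi> i l * z l k) * \<xi> k j) = \<xi> i j)"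
      unfolding mat_eq_iff by (simp add: F_def X_def scalar_prod_def lessThan_atLeast0)
    have 3: "mat_adjoint (F z * X \<xi>) = F z * X \<xi> \<longleftrightarrow>
        (\<forall>i j. i < p \<longrightarrow> j < p \<longrightarrow> conjugate (\<Sum>l<d. z j l * \<xi> l i) = (\<Sum>l<d. z i l * \<xi> l j))"
      unfolding mat_eq_iff by (simp add: F_def X_def scalar_prod_def lessThan_atLeast0)
    have 4: "mat_adjoint (X \<xi> * F z) = X \<xi> * F z \<longleftrightarrow>
        (\<forall>i j. i < d \<longrightarrow> j < d \<longrightarrow> conjugate (\<Sum>l<p. \<xi> j l * z l i) = (\<Sum>l<p. \<xi> i l * z l j))"
      unfolding mat_eq_iff by (simp add: F_def X_def scalar_prod_def lessThan_atLeast0)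
    have "X \<xi> \<in> carrier_mat (dim_col (F z)) (dim_row (F z))" by (simp add: F_def X_def)
    then show ?thesis unfolding is_pseudoinverse_def 1 2 3 4 by blast
  qed
  have closed_C: "closed C"
    unfolding C_def pinv
    by (intro closed_Collect_conj closed_Collect_all closed_Collect_imp open_Collect_const closed_Collect_eq
        continuous_intros fst_c snd_c)
  have closed_C': "closed C'"
  proof -
    have "C' = C \<inter> {w. err (\<lambda>j. \<Sum>k<p. snd w j k * fst w k d) \<le> r}" by (auto simp: C_def C'_def)
    moreover have "closed {w. err (\<lambda>j. \<Sum>k<p. snd w j k * fst w k d) \<le> r}"
      unfolding err_def
      by (intro closed_Collect_le continuous_intros fst_c snd_c)
    ultimately show ?thesis using closed_C by auto
  qed
  \<comment> \<open>The compact sets \<open>S K\<close> together represent every \<open>d\<close> by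
    \<open>p\<close> matrix: its entries are padded by zeros.\<close>
  have ex: "\<exists>\<xi>. P = X \<xi> \<and> (\<exists>K. \<xi> \<in> S K)" if P: "P \<in> carrier_mat d p" for P
  proof -
    define \<xi> where "\<xi> i j = (if i < d \<and> j < p then P $$ (i, j) else 0)" for i j
    define K where "K = nat \<lceil>\<Sum>i<d. \<Sum>j<p. norm (P $$ (i, j))\<rceil>"
    have "P = X \<xi>" using P by (auto simp: X_def \<xi>_def)
    moreover have "norm (\<xi> i j) \<le> real K" for i j
    proof (cases "i < d \<and> j < p")
      case True
      then have "norm (P $$ (i, j)) \<le> (\<Sum>j<p. norm (P $$ (i, j)))"
        by (intro member_le_sum) auto
      also have "\<dots> \<le> (\<Sum>i<d. \<Sum>j<p. norm (P $$ (i, j)))"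
        using True by (intro member_le_sum[of i "{..<d}" "\<lambda>i. \<Sum>j<p. norm (P $$ (i, j))"]) (auto simp: sum_nonneg)
      also have "\<dots> \<le> real K" unfolding K_def by (rule real_nat_ceiling_ge)
      finally show ?thesis using True by (simp add: \<xi>_def)
    qed (auto simp: \<xi>_def)
    ultimately show ?thesis unfolding S_def by blast
  qed
  have Xg: "err (vec_index (X \<xi> *\<^sub>v g z)) = err (\<lambda>j. \<Sum>k<p. \<xi> j k * z k d)" for \<xi> z
    unfolding err_def X_def g_def by (simp add: scalar_prod_def lessThan_atLeast0)
  have carr: "P \<in> carrier_mat d p" if "is_pseudoinverse (F z) P" for P z
    using that unfolding is_pseudoinverse_def F_def by simp

  \<comment> \<open>\<open>D\<close> collects the inputs that have a pseudoinverse,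
    \<open>D'\<close> those which moreover have a small error. Both are countable unions of closed
    sets, one for each bound \<open>K\<close> on the inverse.\<close>
  define D where "D = (\<Union>K. {z. \<exists>\<xi>\<in>S K. (z, \<xi>) \<in> C})"
  define D' where "D' = (\<Union>K. {z. \<exists>\<xi>\<in>S K. (z, \<xi>) \<in> C'})"
  have borel: "D \<in> sets borel" "D' \<in> sets borel"
    unfolding D_def D'_def S_def
    by (intro sets.countable_UN image_subsetI borel_closed closed_projection_of_compact closed_C closed_C' compact_bounded_arrays)+
  have D: "z \<in> D \<longleftrightarrow> (\<exists>P. is_pseudoinverse (F z) P)" for z
    unfolding D_def C_def using ex carr by fastforce
  have D': "z \<in> D' \<longleftrightarrow> z \<in> D \<and> err (vec_index (pseudoinverse (F z) *\<^sub>v g z)) \<le> r" for z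
  proof
    assume "z \<in> D'"
    then obtain \<xi> where \<xi>: "is_pseudoinverse (F z) (X \<xi>)" "err (\<lambda>j. \<Sum>k<p. \<xi> j k * z k d) \<le> r"
      unfolding D'_def C'_def by auto
    then show "z \<in> D \<and> err (vec_index (pseudoinverse (F z) *\<^sub>v g z)) \<le> r"
      using D[of z] by (auto simp: pseudoinverse_eqI[OF \<xi>(1)] Xg)
  next
    assume a: "z \<in> D \<and> err (vec_index (pseudoinverse (F z) *\<^sub>v g z)) \<le> r"
    then obtain P where P: "is_pseudoinverse (F z) P" using D by blast
    from ex[OF carr[OF P]] obtain \<xi> K where \<xi>: "P = X \<xi>" "\<xi> \<in> S K" by blast
    have "(z, \<xi>) \<in> C'"
      using a P unfolding C'_def pseudoinverse_eqI[OF P] by (simp add: \<xi>(1) Xg)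
    then show "z \<in> D'" unfolding D'_def using \<xi>(2) by blast
  qed
  define X0 :: "'a mat" where "X0 = (THE X. False)"
  have X0: "pseudoinverse (F z) = X0" if "z \<notin> D" for z
  proof -
    have "is_pseudoinverse (F z) = (\<lambda>_. False)" using that D by blast
    then show ?thesis by (simp add: pseudoinverse_def X0_def)
  qed
  have coord [measurable]: "(\<lambda>z :: nat \<Rightarrow> nat \<Rightarrow> 'a. z i j) \<in> borel_measurable borel" for i j
    by (rule borel_measurable_continuous_onI[OF array_coordinate_continuous[OF continuous_on_id]])
  \<comment> \<open>The dimensions of the fixed matrix \<open>X0\<close> are unknown, so
    \<open>j\<close> may lie beyond the end of the product.\<close>
  have "(\<lambda>z. (X0 *\<^sub>v g z) $ j) \<in> borel_measurable borel" for j
  proof (cases "j < dim_row X0")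
    case True
    then have "(\<lambda>z. (X0 *\<^sub>v g z) $ j) = (\<lambda>z. \<Sum>k<p. row X0 j $ k * z k d)"
      by (simp add: g_def scalar_prod_def lessThan_atLeast0)
    then show ?thesis by simp
  next
    case False
    then have "(\<lambda>z. (X0 *\<^sub>v g z) $ j) = (\<lambda>z. vec (dim_row X0) (\<lambda>_. 0) $ j)"
      unfolding mult_mat_vec_def by (intro ext vec_index_ge_dim) simp
    then show ?thesis by simp
  qed
  then have [measurable]: "(\<lambda>z. err (vec_index (X0 *\<^sub>v g z))) \<in> borel_measurable borel"
    unfolding err_def by measurable
  have "{z. err (vec_index (X0 *\<^sub>v g z)) \<le> r} \<in> sets borel" by measurable
  then have "D' \<union> ({z. err (vec_index (X0 *\<^sub>v g z)) \<le> r} - D) \<in> sets borel" using borel by auto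
  also have "D' \<union> ({z. err (vec_index (X0 *\<^sub>v g z)) \<le> r} - D) = {z. err (vec_index (pseudoinverse (F z) *\<^sub>v g z)) \<le> r}"
    using D' X0 by auto
  finally show ?thesis unfolding err F_def g_def .
qed

section \<open>Recovery\<close>

lemma bilinear_query_eq_array_form:
  "A \<in> carrier_mat n n \<Longrightarrow> bilinear_query A (vec n x) (vec n y) = array_form n (\<lambda>ab. A $$ ab) x y"
  by (simp add: bilinear_query_def array_form_def scalar_prod_def lessThan_atLeast0)

lemma array_form_cong:
  "(\<And>k l. k < n \<Longrightarrow> l < n \<Longrightarrow> A (k, l) = B (k, l)) \<Longrightarrow> array_form n A x y = array_form n B x y"
  by (simp add: array_form_def)

lemma array_form_add:
  "array_form n (\<lambda>ab. A ab + B ab) x y = array_form n A x y + array_form n B x y"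
  by (simp add: array_form_def sum.distrib distrib_left distrib_right)

lemma array_form_uminus: "array_form n (\<lambda>ab. - A ab) x y = - array_form n A x y"
  by (simp add: array_form_def sum_negf)

lemma array_sqnorm_eq_sum: "array_sqnorm n A = (\<Sum>ab\<in>{..<n} \<times> {..<n}. (norm (A ab))\<^sup>2)"
  by (simp add: array_sqnorm_def sum.cartesian_product split_beta')

lemma frobenius_norm_diff:
  assumes "B \<in> carrier_mat n n" "A \<in> carrier_mat n n"
  shows "frobenius_norm (B - A) = sqrt (array_sqnorm n (\<lambda>ab. B $$ ab - A $$ ab))"
  using assms by (simp add: frobenius_norm_def array_sqnorm_def)

lemma mat_lincomb_carrier [simp]: "mat_lincomb n d c M \<in> carrier_mat n n"
  by (simp add: mat_lincomb_def)

text \<open>The deterministic half. Write B as a combination of the \<open>M j\<close> with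
  coefficients \<open>c\<close>, plus the residual \<open>R b\<close>, so that the responses are
  exact answers for \<open>c\<close> plus noise. The recovered matrix misses B by \<open>R b\<close>
  plus some \<open>s\<close> in the span, and \<open>embed\<close> turns the bound on the answers to
  \<open>s\<close> into one on \<open>s\<close> itself. By orthogonality the squares add up.\<close>

lemma recovery_error_le:
  fixes M :: "nat \<Rightarrow> 'a::real_or_complex mat" and B :: "'a mat" and E :: "nat \<Rightarrow> nat \<times> nat \<Rightarrow> 'a"
    and x y :: "nat \<Rightarrow> nat \<Rightarrow> 'a" and b :: "nat \<Rightarrow> 'a" and n d p :: nat
  defines "I \<equiv> {..<n} \<times> {..<n}" and "V \<equiv> \<lambda>j ab. M j $$ ab"
  defines "R \<equiv> \<lambda>b ab. B $$ ab - (\<Sum>j<d. b j * E j ab)"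
  assumes M: "\<And>j. j < d \<Longrightarrow> M j \<in> carrier_mat n n" and indep: "mat_lin_indep n d M"
    and B: "B \<in> carrier_mat n n"
    and E: "orthonormal I E d" "lincombs I E d = lincombs I V d"
    and pyth: "\<And>s. s \<in> lincombs I E d \<Longrightarrow> array_sqnorm n (\<lambda>ab. R b ab + s ab) = array_sqnorm n (R b) + array_sqnorm n s"
    and p: "p > 0"
    and embed: "\<And>c. real p * (\<Sum>j<d. (norm (c j))\<^sup>2)
       \<le> 2304 * (\<Sum>i<p. (norm (array_form n (\<lambda>ab. \<Sum>j<d. c j * E j ab) (x i) (y i)))\<^sup>2)"
    and noise: "(\<Sum>i<p. (norm (array_form n (R b) (x i) (y i)))\<^sup>2) \<le> 30 * real p * array_sqnorm n (R b)"
  shows "frobenius_norm (B - recovered_matrix n d p M B x y) \<le> 263 * best_approx_error n d M B"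
proof -
  have I: "(k, l) \<in> I \<longleftrightarrow> k < n \<and> l < n" for k l by (simp add: I_def)
  have finI: "finite I" by (simp add: I_def)
  define \<rho> where "\<rho> = array_sqnorm n (R b)"
  have sq_cong: "array_sqnorm n s = array_sqnorm n s'" if "\<And>ab. ab \<in> I \<Longrightarrow> s ab = s' ab" for s s' :: "nat \<times> nat \<Rightarrow> 'a"
    using that unfolding array_sqnorm_eq_sum I_def by (intro sum.cong) auto
  have form_cong: "array_form n s (x i) (y i) = array_form n s' (x i) (y i)"
    if "\<And>ab. ab \<in> I \<Longrightarrow> s ab = s' ab" for s s' :: "nat \<times> nat \<Rightarrow> 'a" and i
    by (rule array_form_cong) (simp add: that I)
  have small: "real p * array_sqnorm n s \<le> 2304 * (\<Sum>i<p. (norm (array_form n s (x i) (y i)))\<^sup>2)"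
    if s: "s \<in> lincombs I V d" for s
  proof -
    from s[folded E(2)] obtain a where a: "\<And>ab. ab \<in> I \<Longrightarrow> s ab = (\<Sum>j<d. a j * E j ab)"
      unfolding lincombs_def by blast
    let ?s = "\<lambda>ab. \<Sum>j<d. a j * E j ab"
    have "array_sqnorm n s = array_sqnorm n ?s" by (rule sq_cong) (rule a)
    also have "\<dots> = (\<Sum>j<d. (norm (a j))\<^sup>2)"
      unfolding array_sqnorm_eq_sum I_def[symmetric]
      by (rule norm_square_orthonormal_lincomb[OF finI E(1)])
    finally have "real p * array_sqnorm n s \<le> 2304 * (\<Sum>i<p. (norm (array_form n ?s (x i) (y i)))\<^sup>2)"
      using embed[of a] by simp
    moreover have "array_form n s (x i) (y i) = array_form n ?s (x i) (y i)" for i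
      by (rule form_cong) (rule a)
    ultimately show ?thesis by simp
  qed

  have "(\<lambda>ab. \<Sum>j<d. b j * E j ab) \<in> lincombs I V d"
    unfolding E(2)[symmetric] by (rule lincombsI) simp
  then obtain c where c: "\<And>ab. ab \<in> I \<Longrightarrow> (\<Sum>j<d. b j * E j ab) = (\<Sum>j<d. c j * V j ab)"
    unfolding lincombs_def by blast
  define A where "A = query_matrix n d p M x y"
  define g where "g = query_response n p B x y"
  define h where "h = vec p (\<lambda>i. array_form n (R b) (x i) (y i))"
  have A: "A \<in> carrier_mat p d" by (simp add: A_def query_matrix_def)
  have h: "h \<in> carrier_vec p" by (simp add: h_def)
  have Av: "(A *\<^sub>v v) $ i = array_form n (\<lambda>ab. \<Sum>j<d. v $ j * V j ab) (x i) (y i)"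
    if "v \<in> carrier_vec d" "i < p" for v i
  proof -
    have "(A *\<^sub>v v) $ i = (\<Sum>j<d. array_form n (V j) (x i) (y i) * v $ j)"
      using that A M by (simp add: scalar_prod_def lessThan_atLeast0 A_def query_matrix_def
          bilinear_query_eq_array_form V_def)
    then show ?thesis by (simp add: array_form_lincomb mult.commute)
  qed
  have g: "g = A *\<^sub>v vec d c + h"
  proof (rule eq_vecI)
    fix i assume "i < dim_vec (A *\<^sub>v vec d c + h)"
    then have i: "i < p" by (simp add: h_def)
    have "g $ i = array_form n (\<lambda>ab. B $$ ab) (x i) (y i)"
      using i by (simp add: g_def query_response_def bilinear_query_eq_array_form[OF B])
    also have "\<dots> = array_form n (\<lambda>ab. (\<Sum>j<d. vec d c $ j * V j ab) + R b ab) (x i) (y i)"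
      by (rule form_cong) (simp add: c R_def)
    also have "\<dots> = (A *\<^sub>v vec d c) $ i + h $ i"
      using i by (simp only: array_form_add Av[OF vec_carrier i]) (simp add: h_def)
    finally show "g $ i = (A *\<^sub>v vec d c + h) $ i" using i h by simp
  qed (simp add: g_def query_response_def h_def)
  \<comment> \<open>The lower bound forces a combination with all answers zero to vanish, and linear
    independence then kills its coefficients.\<close>
  have inj: "v = 0\<^sub>v d" if v: "v \<in> carrier_vec d" and Av0: "A *\<^sub>v v = 0\<^sub>v p" for v
  proof -
    let ?s = "\<lambda>ab. \<Sum>j<d. v $ j * V j ab"
    have "array_form n ?s (x i) (y i) = 0" if "i < p" for i
      using Av[OF v that] Av0 that by simp
    then have "real p * array_sqnorm n ?s \<le> 0"
      using small[of ?s] lincombsI[where f = ?s and c = "\<lambda>j. v $ j" and I = I and V = V and d = d] by simp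
    then have "array_sqnorm n ?s = 0"
      using p array_sqnorm_nonneg[of n ?s] by (simp add: mult_le_0_iff)
    then have "\<forall>ab\<in>I. ?s ab = 0"
      unfolding array_sqnorm_eq_sum I_def[symmetric] using finI by (simp add: sum_nonneg_eq_0_iff)
    then have "mat_lincomb n d (\<lambda>j. v $ j) M = 0\<^sub>m n n"
      unfolding mat_lincomb_def V_def by (intro eq_matI) (auto simp: I)
    then have "\<forall>j<d. v $ j = 0" using indep unfolding mat_lin_indep_def by blast
    then show ?thesis using v by (intro eq_vecI) auto
  qed
  define u where "u = pseudoinverse A *\<^sub>v g - vec d c"
  have u: "u \<in> carrier_vec d" "(\<Sum>i<p. (norm ((A *\<^sub>v u) $ i))\<^sup>2) \<le> (\<Sum>i<p. (norm (h $ i))\<^sup>2)"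
    unfolding u_def g using pseudoinverse_noise_bound[OF A inj vec_carrier h] by simp_all
  define s where "s = (\<lambda>ab. \<Sum>j<d. - (u $ j) * V j ab)"
  have s: "s \<in> lincombs I V d" unfolding s_def by (rule lincombsI) (rule refl)
  have "(norm (array_form n s (x i) (y i)))\<^sup>2 = (norm ((A *\<^sub>v u) $ i))\<^sup>2" if "i < p" for i
  proof -
    have "array_form n s (x i) (y i) = - (A *\<^sub>v u) $ i"
      unfolding Av[OF u(1) that] s_def by (simp add: sum_negf array_form_uminus)
    then show ?thesis by simp
  qed
  then have "real p * array_sqnorm n s \<le> 2304 * (\<Sum>i<p. (norm ((A *\<^sub>v u) $ i))\<^sup>2)"
    using small[OF s] by simp
  also have "\<dots> \<le> 2304 * (\<Sum>i<p. (norm (h $ i))\<^sup>2)" using u(2) by simp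
  also have "\<dots> \<le> 2304 * (30 * real p * \<rho>)" using noise by (simp add: h_def \<rho>_def)
  finally have "real p * array_sqnorm n s \<le> real p * (69120 * \<rho>)" by simp
  then have s_le: "array_sqnorm n s \<le> 69120 * \<rho>" using p by (simp only: mult_le_cancel_left_pos of_nat_0_less_iff)
  have \<rho>0: "\<rho> \<ge> 0" by (simp add: \<rho>_def array_sqnorm_nonneg)

  have pinv_dim: "dim_vec (pseudoinverse A *\<^sub>v g) = d"
    using injective_is_pseudoinverse[OF A inj] pseudoinverse_eqI A
    by (metis carrier_matD(1) carrier_matD(2) dim_mult_mat_vec is_pseudoinverse_def)
  have "frobenius_norm (B - recovered_matrix n d p M B x y)
     = sqrt (array_sqnorm n (\<lambda>ab. B $$ ab - mat_lincomb n d (vec_index (pseudoinverse A *\<^sub>v g)) M $$ ab))"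
    unfolding recovered_matrix_def A_def[symmetric] g_def[symmetric] using B by (intro frobenius_norm_diff) simp_all
  also have "array_sqnorm n (\<lambda>ab. B $$ ab - mat_lincomb n d (vec_index (pseudoinverse A *\<^sub>v g)) M $$ ab)
     = array_sqnorm n (\<lambda>ab. R b ab + s ab)"
  proof (rule sq_cong)
    fix ab assume ab: "ab \<in> I"
    have "mat_lincomb n d (vec_index (pseudoinverse A *\<^sub>v g)) M $$ ab = (\<Sum>j<d. (pseudoinverse A *\<^sub>v g) $ j * V j ab)"
      using ab by (cases ab) (simp add: mat_lincomb_def V_def I)
    also have "\<dots> = (\<Sum>j<d. u $ j * V j ab) + (\<Sum>j<d. c j * V j ab)"
      unfolding sum.distrib[symmetric] u_def using pinv_dim
      by (intro sum.cong refl) (simp add: algebra_simps)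
    finally show "B $$ ab - mat_lincomb n d (vec_index (pseudoinverse A *\<^sub>v g)) M $$ ab = R b ab + s ab"
      by (simp add: R_def s_def c[OF ab] sum_negf)
  qed
  also have "\<dots> = \<rho> + array_sqnorm n s" using pyth[of s] s E(2) by (simp add: \<rho>_def)
  \<comment> \<open>Here 69120 = 2304 * 30, and 263 is the least integer whose square, 69169, is at
    least 1 + 69120.\<close>
  also have "sqrt \<dots> \<le> sqrt (263\<^sup>2 * \<rho>)" using s_le \<rho>0 by simp
  also have "\<dots> = 263 * sqrt \<rho>" by (simp add: real_sqrt_mult)
  also have "sqrt \<rho> \<le> best_approx_error n d M B"
    unfolding best_approx_error_def
  proof (rule cINF_greatest)
    show "mat_span n d M \<noteq> {}" by (auto simp: mat_span_def)
    fix A' assume "A' \<in> mat_span n d M"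
    then obtain a where a: "A' = mat_lincomb n d a M" by (auto simp: mat_span_def)
    \<comment> \<open>A competitor differs from the projection by this element of the span, so by
      Pythagoras its squared error is at least \<open>\<rho>\<close>.\<close>
    define s' where "s' = (\<lambda>ab. \<Sum>j<d. (c j - a j) * V j ab)"
    have s': "s' \<in> lincombs I V d" unfolding s'_def by (rule lincombsI) (rule refl)
    have "array_sqnorm n (\<lambda>ab. B $$ ab - A' $$ ab) = array_sqnorm n (\<lambda>ab. R b ab + s' ab)"
    proof (rule sq_cong)
      fix ab assume ab: "ab \<in> I"
      have "A' $$ ab = (\<Sum>j<d. a j * V j ab)"
        using ab by (cases ab) (simp add: a mat_lincomb_def V_def I)
      then show "B $$ ab - A' $$ ab = R b ab + s' ab"
        by (simp add: R_def s'_def c[OF ab] left_diff_distrib sum_subtractf)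
    qed
    also have "\<dots> = \<rho> + array_sqnorm n s'" using pyth[of s'] s' E(2) by (simp add: \<rho>_def)
    finally show "sqrt \<rho> \<le> frobenius_norm (B - A')"
      using array_sqnorm_nonneg[of n s'] B by (subst frobenius_norm_diff) (auto simp: a)
  qed
  finally show ?thesis by simp
qed

section \<open>Measurability and probability of successful recovery\<close>

context normal_scalar
begin

lemma prob_space_query_space: "prob_space (query_space N n p)"
  unfolding query_space_def by (intro prob_space_pair prob_space_PiM prob_space_vector_law)

lemma sets_recovery_event:
  assumes M: "\<And>j. j < d \<Longrightarrow> M j \<in> carrier_mat n n" and B: "B \<in> carrier_mat n n"
  shows "{(x, y) \<in> space (query_space N n p). frobenius_norm (B - recovered_matrix n d p M B x y) \<le> r}
    \<in> sets (query_space N n p)"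
proof -
  let ?Q = "query_space N n p"
  \<comment> \<open>Queries to the \<open>M j\<close> and to \<open>B\<close> are put into one
    array: the columns below \<open>d\<close> give the query matrix, column \<open>d\<close> the
    responses. Rows from \<open>p\<close> on are filled with 0, which makes every coordinate
    measurable.\<close>
  define A where "A j = (if j < d then M j else B)" for j
  define \<Psi> where "\<Psi> w i j = (if i < p then array_form n (\<lambda>ab. A j $$ ab) (fst w i) (snd w i) else 0)" for w i j
  have "(\<lambda>w. \<Psi> w i j) \<in> borel_measurable ?Q" for i j
  proof (cases "i < p")
    case True
    then have i: "i \<in> {..<p}" by simp
    have "(\<lambda>w. (fst w i, snd w i)) \<in> measurable ?Q (query_law n)"
      unfolding query_space_def
      by (intro measurable_Pair measurable_compose[OF measurable_fst measurable_component_singleton[OF i]]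
          measurable_compose[OF measurable_snd measurable_component_singleton[OF i]])
    from measurable_compose[OF this measurable_array_form] show ?thesis using True by (simp add: \<Psi>_def)
  next
    case False
    then show ?thesis by (simp add: \<Psi>_def)
  qed
  then have \<Psi>: "\<Psi> \<in> borel_measurable ?Q"
    by (intro measurable_coordinatewise_then_product)
  have F: "query_matrix n d p M x y = mat p d (\<lambda>(i, j). \<Psi> (x, y) i j)" for x y
    unfolding query_matrix_def by (intro eq_matI) (auto simp: \<Psi>_def A_def bilinear_query_eq_array_form M)
  have g: "query_response n p B x y = vec p (\<lambda>i. \<Psi> (x, y) i d)" for x y
    unfolding query_response_def by (intro eq_vecI) (auto simp: \<Psi>_def A_def bilinear_query_eq_array_form B)
  have "{(x, y) \<in> space ?Q. frobenius_norm (B - recovered_matrix n d p M B x y) \<le> r}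
    = \<Psi> -` {z. frobenius_norm (B - mat_lincomb n d
      (vec_index (pseudoinverse (mat p d (\<lambda>(i, j). z i j)) *\<^sub>v vec p (\<lambda>i. z i d))) M) \<le> r} \<inter> space ?Q"
    unfolding recovered_matrix_def F g by auto
  also have "\<dots> \<in> sets ?Q" by (rule measurable_sets[OF \<Psi> borel_recovery_event[OF B]])
  finally show ?thesis .
qed

theorem recovery_probability:
  assumes M: "\<And>j. j < d \<Longrightarrow> M j \<in> carrier_mat n n" and indep: "mat_lin_indep n d M"
    and B: "B \<in> carrier_mat n n"
  shows "measure (query_space N n (2073600 * d))
    {(x, y) \<in> space (query_space N n (2073600 * d)).
       frobenius_norm (B - recovered_matrix n d (2073600 * d) M B x y) \<le> 263 * best_approx_error n d M B} \<ge> 9 / 10"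
\<comment> \<open>For \<open>d = 0\<close> there are no queries, and the span consists of the zero
  matrix, which is also what is recovered.\<close>
proof (cases "d = 0")
  case True
  interpret Q: prob_space "query_space N n (2073600 * d)" by (rule prob_space_query_space)
  have "mat_lincomb n d c M = 0\<^sub>m n n" for c using True by (auto simp: mat_lincomb_def)
  then have "frobenius_norm (B - recovered_matrix n d (2073600 * d) M B x y) \<le> 263 * best_approx_error n d M B" for x y
    by (simp add: recovered_matrix_def best_approx_error_def mat_span_def frobenius_norm_def sum_nonneg)
  then show ?thesis using Q.prob_space by simp
next
  case False
  define p where "p = 2073600 * d"
  let ?Q = "query_space N n p" and ?P = "\<Pi>\<^sub>M i\<in>{..<p}. query_law n"
  define I where "I = {..<n} \<times> {..<n}"
  define V where "V j ab = M j $$ ab" for j ab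
  have I: "finite I" by (simp add: I_def)
  have p: "p > 0" using False by (simp add: p_def)
  have "\<forall>j<d. c j = 0" if "\<forall>ab\<in>I. (\<Sum>j<d. c j * V j ab) = 0" for c
  proof -
    have "mat_lincomb n d c M = 0\<^sub>m n n"
      using that unfolding mat_lincomb_def by (intro eq_matI) (auto simp: I_def V_def)
    then show ?thesis using indep unfolding mat_lin_indep_def by blast
  qed
  from orthonormal_basis_exists[OF I this] obtain E where
    E: "orthonormal I E d" "lincombs I E d = lincombs I V d" by blast
  obtain b where b: "\<And>s. s \<in> lincombs I E d \<Longrightarrow>
    (\<Sum>ab\<in>I. (norm (B $$ ab - (\<Sum>j<d. b j * E j ab) + s ab))\<^sup>2)
      = (\<Sum>ab\<in>I. (norm (B $$ ab - (\<Sum>j<d. b j * E j ab)))\<^sup>2) + (\<Sum>ab\<in>I. (norm (s ab))\<^sup>2)"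
    using orthonormal_projection[OF I E(1), of "\<lambda>ab. B $$ ab"] by blast
  let ?R = "\<lambda>ab. B $$ ab - (\<Sum>j<d. b j * E j ab)"
  have En: "array_sqnorm n (\<lambda>ab. \<Sum>j<d. c j * E j ab) = (\<Sum>j<d. (norm (c j))\<^sup>2)" for c
    unfolding array_sqnorm_eq_sum I_def[symmetric] by (rule norm_square_orthonormal_lincomb[OF I E(1)])
  obtain G where G: "G \<in> sets ?P" "measure ?P G \<ge> 9 / 10"
    "\<And>z c. z \<in> G \<Longrightarrow> real p * (\<Sum>j<d. (norm (c j))\<^sup>2)
       \<le> 2304 * (\<Sum>i<p. (norm (array_form n (\<lambda>ab. \<Sum>j<d. c j * E j ab) (fst (z i)) (snd (z i))))\<^sup>2)"
    "\<And>z. z \<in> G \<Longrightarrow> (\<Sum>i<p. (norm (array_form n ?R (fst (z i)) (snd (z i))))\<^sup>2) \<le> 30 * real p * array_sqnorm n ?R"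
    using random_queries_bounds[of d n E ?R] False En unfolding p_def by blast
  \<comment> \<open>\<open>h\<close> sorts the iid pairs back into all x's and all y's. Its image
    law is that of the queries, so the event \<open>G\<close> on the pairs bounds the probability of
    \<open>Ev\<close> from below.\<close>
  define h where "h z = (\<lambda>i\<in>{..<p}. fst (z i), \<lambda>i\<in>{..<p}. snd (z i))" for z :: "nat \<Rightarrow> (nat \<Rightarrow> 'a) \<times> (nat \<Rightarrow> 'a)"
  define Ev where "Ev = {(x, y) \<in> space ?Q. frobenius_norm (B - recovered_matrix n d p M B x y) \<le> 263 * best_approx_error n d M B}"
  have Q: "?Q = distr ?P ?Q h"
    unfolding query_space_def h_def by (rule distr_PiM_pair[OF prob_space_vector_law prob_space_vector_law]) simp
  have h: "h \<in> measurable ?P ?Q" unfolding query_space_def h_def by measurable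
  have Ev: "Ev \<in> sets ?Q" unfolding Ev_def by (rule sets_recovery_event[OF M B])
  interpret P: prob_space ?P by (intro prob_space_PiM prob_space_query_law)
  have "G \<subseteq> h -` Ev \<inter> space ?P"
  proof
    fix z assume z: "z \<in> G"
    then have zP: "z \<in> space ?P" using G(1) sets.sets_into_space by blast
    obtain x y where xy: "h z = (x, y)" by (cases "h z")
    then have xyi: "x i = fst (z i)" "y i = snd (z i)" if "i < p" for i
      using that by (auto simp: h_def)
    have "frobenius_norm (B - recovered_matrix n d p M B x y) \<le> 263 * best_approx_error n d M B"
    proof (rule recovery_error_le[where E = E and b = b, OF M indep B E[unfolded I_def V_def] _ p])
      show "array_sqnorm n (\<lambda>ab. ?R ab + s ab) = array_sqnorm n ?R + array_sqnorm n s"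
        if "s \<in> lincombs ({..<n} \<times> {..<n}) E d" for s
        unfolding array_sqnorm_eq_sum using b[of s] that by (simp add: I_def)
      show "real p * (\<Sum>j<d. (norm (c j))\<^sup>2)
         \<le> 2304 * (\<Sum>i<p. (norm (array_form n (\<lambda>ab. \<Sum>j<d. c j * E j ab) (x i) (y i)))\<^sup>2)" for c
        using G(3)[OF z, of c] by (simp add: xyi)
      show "(\<Sum>i<p. (norm (array_form n ?R (x i) (y i)))\<^sup>2) \<le> 30 * real p * array_sqnorm n ?R"
        using G(4)[OF z] by (simp add: xyi)
    qed
    then show "z \<in> h -` Ev \<inter> space ?P"
      using zP measurable_space[OF h zP] xy by (simp add: Ev_def)
  qed
  then have "measure ?P G \<le> measure ?P (h -` Ev \<inter> space ?P)"
    by (intro P.finite_measure_mono measurable_sets[OF h Ev])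
  also have "\<dots> = measure (distr ?P ?Q h) Ev" by (rule measure_distr[OF h Ev, symmetric])
  also have "\<dots> = measure ?Q Ev" using Q by simp
  finally show ?thesis using G(2) unfolding Ev_def p_def by linarith
qed

end

text \<open>The witnesses are C = 263 and C' = 2073600 = 1440^2 for both fields. The number of
  queries is \<open>2073600 * d\<close>, the same for all \<open>B\<close>.\<close>

theorem theorem5p3:
  shows "\<exists>C C' :: real. C \<ge> 1 \<and> C' > 0 \<and>
    (\<forall>(n::nat) (d::nat) (M :: nat \<Rightarrow> real mat).
       (\<forall>j<d. M j \<in> carrier_mat n n) \<and> mat_lin_indep n d M \<longrightarrow>
       (\<exists>p::nat. real p \<le> C' * real d \<and>
          (\<forall>B \<in> carrier_mat n n.
             measure (query_space std_normal_distribution n p)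
               {(x, y) \<in> space (query_space std_normal_distribution n p).
                  frobenius_norm (B - recovered_matrix n d p M B x y)
                    \<le> C * best_approx_error n d M B} \<ge> 9 / 10))) \<and>
    (\<forall>(n::nat) (d::nat) (M :: nat \<Rightarrow> complex mat).
       (\<forall>j<d. M j \<in> carrier_mat n n) \<and> mat_lin_indep n d M \<longrightarrow>
       (\<exists>p::nat. real p \<le> C' * real d \<and>
          (\<forall>B \<in> carrier_mat n n.
             measure (query_space complex_std_normal n p)
               {(x, y) \<in> space (query_space complex_std_normal n p).
                  frobenius_norm (B - recovered_matrix n d p M B x y)
                    \<le> C * best_approx_error n d M B} \<ge> 9 / 10)))"
proof -
  have real: "\<exists>p. real p \<le> 2073600 * real d \<and> (\<forall>B \<in> carrier_mat n n.
      measure (query_space std_normal_distribution n p)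
        {(x, y) \<in> space (query_space std_normal_distribution n p).
           frobenius_norm (B - recovered_matrix n d p M B x y) \<le> 263 * best_approx_error n d M B} \<ge> 9 / 10)"
    if "(\<forall>j<d. M j \<in> carrier_mat n n) \<and> mat_lin_indep n d M" for n d and M :: "nat \<Rightarrow> real mat"
    using normal_scalar.recovery_probability[OF normal_scalar_real, of d M n] that
    by (intro exI[of _ "2073600 * d"]) simp
  have complex: "\<exists>p. real p \<le> 2073600 * real d \<and> (\<forall>B \<in> carrier_mat n n.
      measure (query_space complex_std_normal n p)
        {(x, y) \<in> space (query_space complex_std_normal n p).
           frobenius_norm (B - recovered_matrix n d p M B x y) \<le> 263 * best_approx_error n d M B} \<ge> 9 / 10)"
    if "(\<forall>j<d. M j \<in> carrier_mat n n) \<and> mat_lin_indep n d M" for n d and M :: "nat \<Rightarrow> complex mat"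
    using normal_scalar.recovery_probability[OF normal_scalar_complex, of d M n] that
    by (intro exI[of _ "2073600 * d"]) simp
  show ?thesis
    by (rule exI[of _ "263 :: real"], rule exI[of _ "2073600 :: real"], intro conjI allI impI)
      (simp, simp, erule real, erule complex)
qed

end
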